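(* Let $\sigma=\lambda/\nu$ be a balanced skew shape of height $a$ and width $b$, and let $w\in\mathfrak{S}_n$ be a skew vexillary permutation of shape $\sigma$. Then the weak order interval $[e,w]$ is CDE with edge density $ab/(a+b)$; that is, $$\mathbb{E}(\mathrm{uni}_{[e,w]};\mathrm{ddeg})=\mathbb{E}(\mathrm{maxchain}_{[e,w]};\mathrm{ddeg})=\frac{ab}{a+b}.$$
   Context: CDE: For a finite poset $P$, $\mathrm{ddeg}(p)$ is the number of elements of $P$ covered by $p$. $\mathrm{uni}_P$ is the uniform distribution on $P$; $\mathrm{maxchain}_P$ is the distribution in which $p$ has probability proportional to the number of maximal chains of $P$ containing $p$. $\mathbb{E}(\mu;f)$ is the expectation of a statistic $f$ with respect to a distribution $\mu$. $P$ is CDE (has the coincidental down-degree expectations property) if $\mathbb{E}(\mathrm{uni}_P;\mathrm{ddeg})=\mathbb{E}(\mathrm{maxchain}_P;\mathrm{ddeg})$. The edge density of $P$ is $\mathbb{E}(\mathrm{uni}_P;\mathrm{ddeg})$, i.e. the number of cover relations divided by $\#P$. Weak order: For $w\in\mathfrak{S}_n$, $\mathrm{Inv}(w)=\{(i,j): 1\le i<j\le n,\ w(i)>w(j)\}$ and $\mathrm{Inv}^{-1}(w)=\mathrm{Inv}(w^{-1})$. Weak order on $\mathfrak{S}_n$ is: $u\le w$ iff $\mathrm{Inv}^{-1}(u)\subseteq \mathrm{Inv}^{-1}(w)$; equivalently, it is the partial order whose cover relations are $u\lessdot us_k$ with $u(k)<u(k+1)$, $s_k$ the simple transposition of $k,k+1$.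 $e$ is the identity; $[e,w]=\{u:e\le u\le w\}$ with the induced order. Shapes: A diagram is a finite subset of $\mathbb{Z}^2$ of boxes $(i,j)$ in matrix coordinates ($i$ = row, increasing downwards; $j$ = column, increasing rightwards). A partition $\lambda$ is identified with its Young diagram $\{(i,j):1\le i\le \ell(\lambda),1\le j\le\lambda_i\}$. For partitions with $\nu_i\le\lambda_i$ for all $i$, the skew shape $\sigma=\lambda/\nu$ is the set difference of the Young diagrams. $\sigma$ is connected if the Hasse diagram of the poset on its boxes (with order induced from the componentwise order on $\mathbb{Z}^2$) is connected (in particular nonempty). A connected $\sigma$ has height $a$ and width $b$ if $[a]\times[b]$ is the smallest rectangle containing $\sigma$ up to translation. Translate $\sigma$ into $[a]\times[b]$; its main antidiagonal is the line joining the northeast and southwest corners of the boundary of this rectangle. A corner of $\sigma$ is a point where two line segments that are part of the boundary of $\sigma$ meet; it is outward if no box of $\sigma$ intersects both line segments (except at the corner point). (Equivalently, outward corners are the lattice points, at the southeast corner of position $(p,q)$, such that exactly three of $(p,q),(p,q+1),(p+1,q),(p+1,q+1)$ lie in $\sigma$; such a point is on the main antidiagonal iff $pb+qa=ab$.) $\sigma$ is balanced if it is connected and all its outward corners lie exactly on its main antidiagonal. Skew vexillary: The Rothe diagram of $w$ is $\{(i,w(j)):(i,j)\in \mathrm{Inv}(w)\}$. $w$ is skew vexillary of shape $\sigma$ if its Rothe diagram can be transformed to $\sigma$ by some permutation of rows and columns (rows and columns being permuted separately). *)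

theory Defs
  imports
    "HOL-Probability.Probability"
    "HOL-Combinatorics.Permutations"
    "HOL-Library.More_List"
begin

section \<open>Down-degree expectations\<close>

text \<open>A finite poset is a finite carrier \<open>P\<close> together with a relation \<open>le\<close>, of which only the
  restriction to \<open>P\<close> matters.\<close>

definition covered_by :: "'a set \<Rightarrow> ('a \<Rightarrow> 'a \<Rightarrow> bool) \<Rightarrow> 'a \<Rightarrow> 'a \<Rightarrow> bool" where
  "covered_by P le q p \<longleftrightarrow> q \<in> P \<and> p \<in> P \<and> le q p \<and> q \<noteq> p \<and>
     \<not> (\<exists>r\<in>P. le q r \<and> le r p \<and> r \<noteq> q \<and> r \<noteq> p)"

definition ddeg :: "'a set \<Rightarrow> ('a \<Rightarrow> 'a \<Rightarrow> bool) \<Rightarrow> 'a \<Rightarrow> nat" where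
  "ddeg P le p = card {q. covered_by P le q p}"

definition uni_distr :: "'a set \<Rightarrow> 'a pmf" where
  "uni_distr P = pmf_of_set P"

text \<open>Each \<open>p\<close> is weighted by the number of maximal chains through it: the distribution is the
  image of the uniform one on pairs \<open>(p, C)\<close> with \<open>p \<in> C\<close>; see \<open>pmf_maxchain_distr\<close> below.\<close>

definition maxchain_distr :: "'a set \<Rightarrow> ('a \<Rightarrow> 'a \<Rightarrow> bool) \<Rightarrow> 'a pmf" where
  "maxchain_distr P le =
     map_pmf fst (pmf_of_set (SIGMA p:P. {C. pred_on.maxchain P le C \<and> p \<in> C}))"

definition expect_ddeg :: "'a set \<Rightarrow> ('a \<Rightarrow> 'a \<Rightarrow> bool) \<Rightarrow> 'a pmf \<Rightarrow> real" where
  "expect_ddeg P le \<mu> = measure_pmf.expectation \<mu> (\<lambda>p. real (ddeg P le p))"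

definition CDE :: "'a set \<Rightarrow> ('a \<Rightarrow> 'a \<Rightarrow> bool) \<Rightarrow> bool" where
  "CDE P le \<longleftrightarrow> expect_ddeg P le (uni_distr P) = expect_ddeg P le (maxchain_distr P le)"

definition edge_density :: "'a set \<Rightarrow> ('a \<Rightarrow> 'a \<Rightarrow> bool) \<Rightarrow> real" where
  "edge_density P le = expect_ddeg P le (uni_distr P)"

lemma finite_maxchains: "finite P \<Longrightarrow> finite {C. pred_on.maxchain P le C}"
  by (rule finite_subset[of _ "Pow P"]) (auto simp: pred_on.maxchain_def pred_on.chain_def)

lemma ex_maxchain_through:
  assumes "finite P" "p \<in> P"
  shows "\<exists>C. pred_on.maxchain P le C \<and> p \<in> C"
proof -
  let ?S = "{C. pred_on.chain P le C \<and> p \<in> C}"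
  have "finite ?S"
    by (rule finite_subset[of _ "Pow P"]) (use assms in \<open>auto simp: pred_on.chain_def\<close>)
  moreover have "{p} \<in> ?S"
    using assms by (auto simp: pred_on.chain_def)
  ultimately obtain C where C: "C \<in> ?S" "\<And>D. D \<in> ?S \<Longrightarrow> C \<subseteq> D \<Longrightarrow> C = D"
    using finite_has_maximal2[of ?S "{p}"] by blast
  then have "pred_on.maxchain P le C"
    unfolding pred_on.maxchain_def by blast
  with C show ?thesis by blast
qed

lemma pmf_maxchain_distr:
  assumes "finite P" "p \<in> P"
  shows "pmf (maxchain_distr P le) p =
    real (card {C. pred_on.maxchain P le C \<and> p \<in> C}) /
    (\<Sum>q\<in>P. real (card {C. pred_on.maxchain P le C \<and> q \<in> C}))"
proof -
  let ?M = "\<lambda>p. {C. pred_on.maxchain P le C \<and> p \<in> C}"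
  let ?S = "SIGMA p:P. ?M p"
  have fin: "finite (?M q)" for q
    by (rule finite_subset[OF _ finite_maxchains[OF assms(1)]]) auto
  have S: "finite ?S" "?S \<noteq> {}"
    using assms fin ex_maxchain_through[OF assms] by auto
  have eq: "?S \<inter> fst -` {p} = Pair p ` ?M p"
    using assms by auto
  have "card (?S \<inter> fst -` {p}) = card (?M p)"
    unfolding eq by (rule card_image) (auto simp: inj_on_def)
  moreover have "card ?S = (\<Sum>q\<in>P. card (?M q))"
    using assms(1) fin by (simp add: card_SigmaI)
  ultimately show ?thesis
    unfolding maxchain_distr_def pmf_map
    using S by (simp add: measure_pmf_of_set)
qed


section \<open>Weak order\<close>

text \<open>Elements of the symmetric group are functions \<open>w\<close> with \<open>w permutes {1..n}\<close>.\<close>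

definition Inversions :: "nat \<Rightarrow> (nat \<Rightarrow> nat) \<Rightarrow> (nat \<times> nat) set" where
  "Inversions n w = {(i, j). 1 \<le> i \<and> i < j \<and> j \<le> n \<and> w i > w j}"

definition weak_le :: "nat \<Rightarrow> (nat \<Rightarrow> nat) \<Rightarrow> (nat \<Rightarrow> nat) \<Rightarrow> bool" where
  "weak_le n u w \<longleftrightarrow> Inversions n (inv u) \<subseteq> Inversions n (inv w)"

definition weak_interval :: "nat \<Rightarrow> (nat \<Rightarrow> nat) \<Rightarrow> (nat \<Rightarrow> nat) \<Rightarrow> (nat \<Rightarrow> nat) set" where
  "weak_interval n v w = {u. u permutes {1..n} \<and> weak_le n v u \<and> weak_le n u w}"


section \<open>Skew shapes\<close>

text \<open>Diagrams are sets of boxes \<open>(row, column)\<close>. A partition is the list of its parts, so that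
  the part with (1-based) index \<open>i\<close> is at list position \<open>i - 1\<close>.\<close>

definition is_partition :: "nat list \<Rightarrow> bool" where
  "is_partition lam \<longleftrightarrow> sorted_wrt (\<ge>) lam \<and> 0 \<notin> set lam"

definition young_diagram :: "nat list \<Rightarrow> (int \<times> int) set" where
  "young_diagram lam =
     {(int i, int j) | i j. 1 \<le> i \<and> i \<le> length lam \<and> 1 \<le> j \<and> j \<le> lam ! (i - 1)}"

definition partition_contained :: "nat list \<Rightarrow> nat list \<Rightarrow> bool" where
  "partition_contained nu lam \<longleftrightarrow> (\<forall>i. nth_default 0 nu i \<le> nth_default 0 lam i)"

definition skew_shape :: "nat list \<Rightarrow> nat list \<Rightarrow> (int \<times> int) set" where
  "skew_shape lam nu = young_diagram lam - young_diagram nu"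

definition box_le :: "int \<times> int \<Rightarrow> int \<times> int \<Rightarrow> bool" where
  "box_le c d \<longleftrightarrow> fst c \<le> fst d \<and> snd c \<le> snd d"

definition connected_diagram :: "(int \<times> int) set \<Rightarrow> bool" where
  "connected_diagram \<sigma> \<longleftrightarrow>
     \<sigma> \<noteq> {} \<and> (\<forall>c\<in>\<sigma>. \<forall>d\<in>\<sigma>. equivclp (covered_by \<sigma> box_le) c d)"

definition rectangle :: "nat \<Rightarrow> nat \<Rightarrow> (int \<times> int) set" where
  "rectangle a b = {1..int a} \<times> {1..int b}"

definition translate :: "int \<times> int \<Rightarrow> (int \<times> int) set \<Rightarrow> (int \<times> int) set" where
  "translate v \<sigma> = (\<lambda>c. v + c) ` \<sigma>"

definition has_height_width :: "(int \<times> int) set \<Rightarrow> nat \<Rightarrow> nat \<Rightarrow> bool" where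
  "has_height_width \<sigma> a b \<longleftrightarrow>
     (\<exists>v. translate v \<sigma> \<subseteq> rectangle a b) \<and>
     (\<forall>a' b'. (\<exists>v. translate v \<sigma> \<subseteq> rectangle a' b') \<longrightarrow> a \<le> a' \<and> b \<le> b')"

text \<open>Geometric realisation in the plane, still in (row, column) coordinates: the box \<open>(i, j)\<close> is
  the unit square whose southeast vertex is the lattice point \<open>(i, j)\<close>.\<close>

definition box_square :: "int \<times> int \<Rightarrow> (real \<times> real) set" where
  "box_square c = {real_of_int (fst c) - 1 .. real_of_int (fst c)} \<times>
                  {real_of_int (snd c) - 1 .. real_of_int (snd c)}"

definition diagram_region :: "(int \<times> int) set \<Rightarrow> (real \<times> real) set" where
  "diagram_region \<sigma> = (\<Union>c\<in>\<sigma>. box_square c)"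

text \<open>The point \<open>x\<close> is a corner if two boundary segments \<open>[x, y]\<close> and \<open>[x, z]\<close> in different
  directions meet there; it is outward if every box meets at most one of them outside \<open>x\<close>.\<close>

definition outward_corner :: "(int \<times> int) set \<Rightarrow> real \<times> real \<Rightarrow> bool" where
  "outward_corner \<sigma> x \<longleftrightarrow>
     (\<exists>y z. \<not> collinear {x, y, z} \<and>
        closed_segment x y \<subseteq> frontier (diagram_region \<sigma>) \<and>
        closed_segment x z \<subseteq> frontier (diagram_region \<sigma>) \<and>
        \<not> (\<exists>c\<in>\<sigma>. box_square c \<inter> (closed_segment x y - {x}) \<noteq> {} \<and>
                 box_square c \<inter> (closed_segment x z - {x}) \<noteq> {}))"

text \<open>The rectangle \<open>[a] \<times> [b]\<close> occupies rows from \<open>0\<close> to \<open>a\<close> and columns from \<open>0\<close> to \<open>b\<close> of the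
  plane, so its northeast and southwest vertices are \<open>(0, b)\<close> and \<open>(a, 0)\<close>.\<close>

definition main_antidiagonal :: "nat \<Rightarrow> nat \<Rightarrow> (real \<times> real) set" where
  "main_antidiagonal a b = affine hull {(0, real b), (real a, 0)}"

definition balanced :: "(int \<times> int) set \<Rightarrow> bool" where
  "balanced \<sigma> \<longleftrightarrow> connected_diagram \<sigma> \<and>
     (\<exists>a b v. has_height_width \<sigma> a b \<and> translate v \<sigma> \<subseteq> rectangle a b \<and>
        (\<forall>x. outward_corner (translate v \<sigma>) x \<longrightarrow> x \<in> main_antidiagonal a b))"


section \<open>Skew vexillary permutations\<close>

definition rothe_diagram :: "nat \<Rightarrow> (nat \<Rightarrow> nat) \<Rightarrow> (int \<times> int) set" where
  "rothe_diagram n w = {(int i, int (w j)) | i j. (i, j) \<in> Inversions n w}"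

definition skew_vexillary_of_shape :: "nat \<Rightarrow> (nat \<Rightarrow> nat) \<Rightarrow> (int \<times> int) set \<Rightarrow> bool" where
  "skew_vexillary_of_shape n w \<sigma> \<longleftrightarrow>
     (\<exists>f g. bij f \<and> bij g \<and> map_prod f g ` rothe_diagram n w = \<sigma>)"

end

theory Submission
  imports Defs
begin

text \<open>
  Read a permutation \<open>u\<close> in the interval as a word. An edge of the interval swaps two neighbouring
  letters \<open>y < x\<close>; label it by \<open>(y, x, Z)\<close>, where \<open>Z\<close> is the set of intermediate letters to the left of
  the pair. Both distributions are toggle symmetric: for each label, the elements with an upward
  edge of this label have the same total weight as those with a downward one. For the maximal chain
  distribution, exchange the values \<open>x\<close> and \<open>y\<close> between the marked element and the place where the
  chain crosses an edge with this label.

  On the other hand there are numbers \<open>d\<close> on the labels such that, for every \<open>u\<close> in the interval, the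
  sum of \<open>d\<close> over the downward edges of \<open>u\<close> plus the sum of \<open>a + b - d\<close> over its upward edges is
  \<open>a b\<close>. Taking expectations, toggle symmetry makes \<open>d\<close> cancel and leaves \<open>(a + b) E(ddeg) = a b\<close>.
  The numbers \<open>d\<close> arise by telescoping a flow along the word. That the flow vanishes at gaps without
  an edge of the interval needs a single consequence of balancedness: for any two rows \<open>R\<close>, \<open>R'\<close> of the
  shape, \<open>b\<close> times the number of rows contained in \<open>R \<inter> R'\<close> is \<open>a\<close> times the size of \<open>R \<inter> R'\<close>.
\<close>

section \<open>Telescoping along a word\<close>

text \<open>The set \<open>Z\<close> serves both halves. It is all that the flow at a pair
  \<open>y < x\<close> of neighbours sees of the rest of the word: letters of \<open>lo y\<close>
  cancel, because \<open>lo y\<close> lies in \<open>lo x\<close>, and letters of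
  \<open>lo x\<close> below \<open>y\<close> but outside \<open>lo y\<close> are forced to the left
  of the pair. It also makes the exchange of \<open>y\<close> and \<open>x\<close> order preserving
  between mark and crossing: every intermediate letter keeps its side there, so no relation with it
  is reversed.

  The constants: each of the \<open>a\<close> letters with a nonempty row is a source of strength
  \<open>b\<close>, which gives \<open>a b\<close>; at an upward edge \<open>y\<close> stands in
  front of \<open>x\<close>, and its weight in the inflow of \<open>x\<close> turns \<open>d\<close>
  into \<open>a + b - d\<close>.

  The condition on rows is a statement about slopes. For rows \<open>r \<le> s\<close> the common
  columns run from \<open>left r + 1\<close> to \<open>right s\<close>, and the rows inside from
  \<open>p' + 1\<close> to \<open>p\<close>, where \<open>(p, left r)\<close> and
  \<open>(p', right s)\<close> are outward corners or ends of the antidiagonal. Since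
  \<open>b p + a q\<close> is constant on that line, the two lengths are in the ratio
  \<open>a : b\<close>.\<close>

definition edge_label :: "(nat \<Rightarrow> nat) \<Rightarrow> nat \<Rightarrow> nat \<times> nat \<times> nat set" where
  "edge_label u k = (let y = min (u k) (u (Suc k)); x = max (u k) (u (Suc k))
     in (y, x, {z. y < z \<and> z < x \<and> inv u z < k}))"

locale inversion_diagram =
  fixes n :: nat and w :: "nat \<Rightarrow> nat"
  assumes w_permutes: "w permutes {1..n}"
begin

text \<open>The row of the Rothe diagram with index \<open>inv w x\<close>. Columns of that diagram
  are letters already; a row is a position and is renamed here by its letter.\<close>

definition lo :: "nat \<Rightarrow> nat set" where
  "lo x = {y. (y, x) \<in> Inversions n (inv w)}"

definition rows :: "nat set" where "rows = {x. lo x \<noteq> {}}"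

definition cols :: "nat set" where "cols = (\<Union>x. lo x)"

definition wt :: "nat \<Rightarrow> int" where
  "wt z = (if z \<in> rows then int (card cols) else 0) - (if z \<in> cols then int (card rows) else 0)"

text \<open>These letters stand to the left of \<open>z\<close> in every word of the interval. They
  form the part of the potential that does not move.\<close>

definition dominated :: "nat \<Rightarrow> nat set" where
  "dominated z = {t \<in> rows. t < z \<and> t \<notin> lo z \<and> lo t \<subseteq> lo z}"

definition before :: "(nat \<Rightarrow> nat) \<Rightarrow> nat \<Rightarrow> nat set" where
  "before u z = {x \<in> {1..n}. inv u x < inv u z}"

text \<open>If the rows and columns of the shape are listed in the order in which the letters appear in
  the word, the word traces a lattice path, and \<open>wt\<close> is the change of \<open>b p + a q - a b\<close> along it at the
  point \<open>(p, q)\<close>. The inflow is minus this potential at the start of the row of \<open>z\<close>, normalised so that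
  it only sees the letters which can still change sides with \<open>z\<close>.\<close>

definition inflow :: "(nat \<Rightarrow> nat) \<Rightarrow> nat \<Rightarrow> int" where
  "inflow u z = - int (card cols) * int (card (dominated z)) - sum wt (before u z \<inter> lo z)"

text \<open>A letter with a nonempty row splits the amount \<open>card cols\<close> between the gap
  in front of it and the gap behind it; other letters only pass on what they receive.\<close>

definition outflow :: "(nat \<Rightarrow> nat) \<Rightarrow> nat \<Rightarrow> int" where
  "outflow u z = (if z \<in> rows then int (card cols) else 0) - inflow u z"

definition gap_value :: "(nat \<Rightarrow> nat) \<Rightarrow> nat \<Rightarrow> int" where
  "gap_value u k = outflow u (u k) + inflow u (u (Suc k))"

lemma lo_iff: "y \<in> lo x \<longleftrightarrow> 1 \<le> y \<and> y < x \<and> x \<le> n \<and> inv w x < inv w y"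
  by (auto simp: lo_def Inversions_def)

lemma lo_subset: "lo x \<subseteq> {1..n}" and finite_lo: "finite (lo x)"
proof -
  show "lo x \<subseteq> {1..n}" by (auto simp: lo_iff)
  then show "finite (lo x)" by (rule finite_subset) simp
qed

lemma rows_subset: "rows \<subseteq> {1..n}" and finite_rows: "finite rows"
proof -
  show "rows \<subseteq> {1..n}" by (auto simp: rows_def lo_iff)
  then show "finite rows" by (rule finite_subset) simp
qed

lemma cols_subset: "cols \<subseteq> {1..n}" and finite_cols: "finite cols"
proof -
  show "cols \<subseteq> {1..n}" by (auto simp: cols_def lo_iff)
  then show "finite cols" by (rule finite_subset) simp
qed

lemma lo_subset_cols: "lo x \<subseteq> cols" by (auto simp: cols_def)

lemma finite_dominated: "finite (dominated z)"
  using finite_rows by (auto simp: dominated_def)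

lemma inv_w_inj: "inv w x = inv w y \<longleftrightarrow> x = y"
  using permutes_inj[OF permutes_inv[OF w_permutes]] by (auto dest: injD)

lemma sum_wt:
  assumes "E \<subseteq> cols"
  shows "sum wt E = int (card cols) * int (card (rows \<inter> E)) - int (card rows) * int (card E)"
proof -
  have fin: "finite E" using assms finite_cols by (rule finite_subset)
  have "sum wt E = (\<Sum>z\<in>E. if z \<in> rows then int (card cols) else 0) - (\<Sum>z\<in>E. int (card rows))"
    unfolding wt_def sum_subtractf[symmetric] using assms by (intro sum.cong) auto
  also have "(\<Sum>z\<in>E. if z \<in> rows then int (card cols) else 0) = int (card cols) * int (card (rows \<inter> E))"
    using fin by (subst sum.inter_restrict[symmetric]) (auto simp: Int_commute)
  finally show ?thesis by simp
qed

text \<open>The number \<open>d\<close> of the overview. The \<open>1\<close> is the source at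
  \<open>x\<close>, whose row is nonempty; only the last summand involves \<open>Z\<close>.\<close>

definition static_value :: "nat \<times> nat \<times> nat set \<Rightarrow> int" where
  "static_value = (\<lambda>(y, x, Z).
     int (card cols) * (1 + int (card (dominated x)) - int (card (dominated y)))
     + sum wt ({z \<in> lo x. z < y} - lo y) + sum wt (Z \<inter> lo x))"

end

section \<open>Telescoping, and the gaps that are edges of the interval\<close>

locale inversion_word = inversion_diagram +
  fixes u :: "nat \<Rightarrow> nat"
  assumes u_permutes: "u permutes {1..n}"
    and u_le: "Inversions n (inv u) \<subseteq> Inversions n (inv w)"
begin

lemma inv_u_inj: "inv u x = inv u y \<longleftrightarrow> x = y"
  using permutes_inj[OF permutes_inv[OF u_permutes]] by (auto dest: injD)

lemma inv_u_apply [simp]: "inv u (u k) = k"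
  using permutes_inj[OF u_permutes] by (simp add: inv_f_f)

lemma apply_inv_u [simp]: "u (inv u x) = x"
  using permutes_inverses(1)[OF u_permutes] .

lemma inv_u_range: "inv u x \<in> {1..n} \<longleftrightarrow> x \<in> {1..n}"
  by (rule permutes_in_image[OF permutes_inv[OF u_permutes]])

lemma u_range: "u k \<in> {1..n} \<longleftrightarrow> k \<in> {1..n}"
  by (rule permutes_in_image[OF u_permutes])

lemma inverted_imp_lo: "1 \<le> y \<Longrightarrow> y < x \<Longrightarrow> x \<le> n \<Longrightarrow> inv u x < inv u y \<Longrightarrow> y \<in> lo x"
  using u_le by (auto simp: lo_def Inversions_def)

lemma not_lo_imp_before:
  assumes "1 \<le> y" "y < x" "x \<le> n" "y \<notin> lo x"
  shows "inv u y < inv u x"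
  using inverted_imp_lo[of y x] assms inv_u_inj[of x y] by (metis linorder_neqE_nat less_irrefl)

text \<open>Regrouping by letters instead of gaps: inflow and outflow of one letter add up to
  \<open>card cols\<close> or \<open>0\<close>, and the two boundary terms that have no gap vanish
  by assumption.\<close>

lemma gap_sum:
  assumes "inflow u (u 1) = 0" "outflow u (u n) = 0" "1 \<le> n"
  shows "(\<Sum>k=1..<n. gap_value u k) = int (card rows) * int (card cols)"
proof -
  have "(\<Sum>k=1..<n. gap_value u k) =
      (\<Sum>k=1..<n. outflow u (u k)) + (\<Sum>k=Suc 1..<Suc n. inflow u (u k))"
    unfolding gap_value_def sum.distrib by (subst sum.shift_bounds_Suc_ivl) simp
  also have "(\<Sum>k=1..<n. outflow u (u k)) = (\<Sum>k=1..<Suc n. outflow u (u k))"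
    using assms by simp
  also have "(\<Sum>k=Suc 1..<Suc n. inflow u (u k)) = (\<Sum>k=1..<Suc n. inflow u (u k))"
    using assms by (subst (2) sum.atLeast_Suc_lessThan) auto
  also have "(\<Sum>k=1..<Suc n. outflow u (u k)) + (\<Sum>k=1..<Suc n. inflow u (u k)) =
      (\<Sum>k\<in>{1..n}. if u k \<in> rows then int (card cols) else 0)"
    unfolding sum.distrib[symmetric] by (intro sum.cong) (auto simp: outflow_def)
  also have "\<dots> = (\<Sum>z\<in>{1..n}. if z \<in> rows then int (card cols) else 0)"
    using permutes_imp_bij[OF u_permutes] by (rule sum.reindex_bij_betw)
  also have "\<dots> = (\<Sum>z\<in>{1..n} \<inter> rows. int (card cols))"
    by (rule sum.inter_restrict[symmetric]) simp
  also have "{1..n} \<inter> rows = rows" using rows_subset by auto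
  finally show ?thesis by simp
qed

text \<open>A dominated letter would have to stand further left.\<close>

lemma inflow_first:
  assumes "1 \<le> n"
  shows "inflow u (u 1) = 0"
proof -
  have "before u (u 1) = {}"
  proof -
    have False if "x \<in> before u (u 1)" for x
      using that inv_u_range[of x] by (auto simp: before_def)
    then show ?thesis by auto
  qed
  moreover have "dominated (u 1) = {}"
  proof -
    have False if "t \<in> dominated (u 1)" for t
    proof -
      have t: "1 \<le> t" "t < u 1" "t \<notin> lo (u 1)" "u 1 \<le> n"
        using that rows_subset u_range[of 1] assms by (auto simp: dominated_def)
      then have "inv u t < inv u (u 1)"
        by (intro not_lo_imp_before) auto
      with inv_u_range[of t] t show False by auto
    qed
    then show ?thesis by auto
  qed
  ultimately show ?thesis by (simp add: inflow_def)
qed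

lemma lo_closed: "t \<in> lo z \<Longrightarrow> lo t \<subseteq> lo z"
  by (auto simp: lo_iff)

text \<open>The neighbours may stand in either order, so that descents and ascents share this
  computation.\<close>

lemma sum_before_diff:
  assumes yx: "y \<in> lo x" and pos: "{inv u x, inv u y} = {k, Suc k}"
  shows "sum wt ({z \<in> {1..n}. inv u z < k} \<inter> lo x) - sum wt ({z \<in> {1..n}. inv u z < k} \<inter> lo y) =
    sum wt ({z \<in> lo x. z < y} - lo y) + sum wt ({z. y < z \<and> z < x \<and> inv u z < k} \<inter> lo x)"
proof -
  let ?A = "{z \<in> {1..n}. inv u z < k}"
  have xn: "y \<in> {1..n}" "x \<in> {1..n}" "y < x" using yx by (auto simp: lo_iff)
  \<comment> \<open>Since \<open>z\<close> is not inverted with \<open>y\<close> in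
    \<open>w\<close>, it precedes \<open>y\<close> in \<open>u\<close>; as it differs from
    \<open>x\<close>, it precedes the whole pair.\<close>
  have before: "inv u z < k" if "z \<in> lo x" "z < y" "z \<notin> lo y" for z
  proof -
    have "inv u z < inv u y"
      using that xn by (intro not_lo_imp_before) (auto simp: lo_iff)
    moreover have "inv u z \<noteq> inv u x"
      using that xn inv_u_inj[of z x] by auto
    ultimately show ?thesis using pos by (auto simp: doubleton_eq_iff)
  qed
  have ny: "\<not> inv u y < k" using pos by (auto simp: doubleton_eq_iff)
  have "?A \<inter> lo x = (?A \<inter> lo y) \<union> (({z \<in> lo x. z < y} - lo y) \<union>
      ({z. y < z \<and> z < x \<and> inv u z < k} \<inter> lo x))" (is "_ = _ \<union> (?B \<union> ?C)")
  proof (intro equalityI subsetI)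
    fix z assume "z \<in> ?A \<inter> lo x"
    moreover from this ny have "z \<noteq> y" by auto
    ultimately show "z \<in> (?A \<inter> lo y) \<union> (?B \<union> ?C)" by (auto simp: lo_iff[of _ x])
  next
    fix z assume "z \<in> (?A \<inter> lo y) \<union> (?B \<union> ?C)"
    then show "z \<in> ?A \<inter> lo x"
      using before[of z] lo_closed[OF yx] lo_subset[of x] by fastforce
  qed
  moreover have "sum wt ((?A \<inter> lo y) \<union> (?B \<union> ?C)) = sum wt (?A \<inter> lo y) + sum wt (?B \<union> ?C)"
    by (rule sum.union_disjoint) (auto simp: finite_lo lo_iff[of _ y])
  moreover have "sum wt (?B \<union> ?C) = sum wt ?B + sum wt ?C"
    by (rule sum.union_disjoint) (auto simp: finite_lo)
  ultimately show ?thesis by simp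
qed

lemma gap_value_descent:
  assumes k: "1 \<le> k" "k < n" and desc: "u (Suc k) < u k"
  shows "gap_value u k = static_value (edge_label u k)"
proof -
  define x where "x = u k"
  define y where "y = u (Suc k)"
  have x: "x \<in> {1..n}" "inv u x = k" and y: "y \<in> {1..n}" "inv u y = Suc k"
    using k u_range[of k] u_range[of "Suc k"] by (auto simp: x_def y_def)
  have yx: "y \<in> lo x" using x y desc by (intro inverted_imp_lo) (auto simp: x_def y_def)
  have lab: "edge_label u k = (y, x, {z. y < z \<and> z < x \<and> inv u z < k})"
    using desc by (simp add: edge_label_def x_def y_def Let_def)
  have "before u x = {z \<in> {1..n}. inv u z < k}" by (simp add: before_def x)
  moreover have "before u y \<inter> lo y = {z \<in> {1..n}. inv u z < k} \<inter> lo y"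
  proof -
    have "inv u z \<noteq> k" if "z \<in> lo y" for z
      using that yx x(2) inv_u_inj[of z x] by (metis less_asym lo_iff)
    then show ?thesis by (auto simp: before_def y less_Suc_eq)
  qed
  moreover have "x \<in> rows" using yx by (auto simp: rows_def)
  ultimately show ?thesis
    using sum_before_diff[OF yx, of k] x y
    unfolding lab gap_value_def x_def[symmetric] y_def[symmetric]
    by (simp add: outflow_def inflow_def static_value_def algebra_simps)
qed

text \<open>Compared with a descent, the source is \<open>y\<close> and the prefix of
  \<open>x\<close> also contains \<open>y\<close>. The row part of \<open>wt y\<close> cancels the
  source of \<open>y\<close>, its column part leaves \<open>card rows\<close>, and
  \<open>card cols\<close> compensates the \<open>1\<close> in \<open>static_value\<close>.\<close>

lemma gap_value_ascent:
  assumes k: "1 \<le> k" "k < n" and asc: "u k < u (Suc k)" and D: "u k \<in> lo (u (Suc k))"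
  shows "gap_value u k = int (card rows) + int (card cols) - static_value (edge_label u k)"
proof -
  define x where "x = u (Suc k)"
  define y where "y = u k"
  have x: "x \<in> {1..n}" "inv u x = Suc k" and y: "y \<in> {1..n}" "inv u y = k"
    using k u_range[of k] u_range[of "Suc k"] by (auto simp: x_def y_def)
  have yx: "y \<in> lo x" using D by (simp add: x_def y_def)
  have lab: "edge_label u k = (y, x, {z. y < z \<and> z < x \<and> inv u z < k})"
    using asc by (simp add: edge_label_def x_def y_def Let_def)
  let ?A = "{z \<in> {1..n}. inv u z < k}"
  have "before u y = ?A" by (simp add: before_def y)
  moreover have "sum wt (before u x \<inter> lo x) = wt y + sum wt (?A \<inter> lo x)"
  proof -
    have "inv u z = k \<longleftrightarrow> z = y" for z
      using y(2) inv_u_inj[of z y] by simp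
    then have "before u x \<inter> lo x = insert y (?A \<inter> lo x)"
      using y(1) yx unfolding before_def x(2) less_Suc_eq by blast
    then show ?thesis using y by (simp add: finite_lo)
  qed
  moreover have "wt y = (if y \<in> rows then int (card cols) else 0) - int (card rows)"
    using yx by (auto simp: wt_def cols_def)
  moreover have "x \<in> rows" using yx by (auto simp: rows_def)
  ultimately show ?thesis
    using sum_before_diff[OF yx, of k] x y
    unfolding lab gap_value_def x_def[symmetric] y_def[symmetric]
    by (simp add: outflow_def inflow_def static_value_def algebra_simps insert_commute)
qed

end

section \<open>Row balance: the end of the word and the gaps without an edge\<close>

locale balanced_inversion_word = inversion_word +
  assumes row_balance: "\<And>x y. int (card cols) * int (card {t \<in> rows. lo t \<subseteq> lo x \<inter> lo y}) =
    int (card rows) * int (card (lo x \<inter> lo y))"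
begin

text \<open>Row balance trades the column term for a number of contained rows. Weights over
  intersections become multiples of \<open>card cols\<close>, and only rows remain to be
  counted.\<close>

lemma sum_wt_lo_inter:
  "sum wt (lo x \<inter> lo y) = int (card cols) *
    (int (card (rows \<inter> (lo x \<inter> lo y))) - int (card {t \<in> rows. lo t \<subseteq> lo x \<inter> lo y}))"
  using sum_wt[of "lo x \<inter> lo y"] lo_subset_cols row_balance[of x y]
  by (auto simp: algebra_simps)

text \<open>If the row of some \<open>t > z\<close> lies in that of the last letter
  \<open>z\<close>, then \<open>z\<close> is not in \<open>lo t\<close>, so \<open>t\<close> would
  have to follow \<open>z\<close>. Hence the rows inside that of \<open>z\<close> belong to letters
  of \<open>lo z\<close>, to \<open>z\<close> or to dominated letters, and these are the terms that
  row balance compares.\<close>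

lemma outflow_last:
  assumes "1 \<le> n"
  shows "outflow u (u n) = 0"
proof -
  let ?z = "u n"
  have z: "?z \<in> {1..n}" using u_range[of n] assms by auto
  have bef: "before u ?z \<inter> lo ?z = lo ?z"
  proof -
    have "inv u x < n" if "x \<in> lo ?z" for x
    proof -
      have "x \<in> {1..n}" "x \<noteq> ?z" using that by (auto simp: lo_iff)
      moreover have "inv u x \<noteq> n"
        using \<open>x \<noteq> ?z\<close> apply_inv_u[of x] by auto
      ultimately show ?thesis using inv_u_range[of x] by auto
    qed
    then show ?thesis using lo_subset by (fastforce simp: before_def)
  qed
  have eq: "{t \<in> rows. lo t \<subseteq> lo ?z} = (rows \<inter> lo ?z) \<union> (rows \<inter> {?z}) \<union> dominated ?z"
  proof -
    have "t \<in> lo ?z \<or> t = ?z \<or> t < ?z" if t: "t \<in> rows" "lo t \<subseteq> lo ?z" for t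
    proof (rule ccontr)
      assume *: "\<not> ?thesis"
      have t1: "t \<in> {1..n}" using t rows_subset by auto
      have "?z \<notin> lo ?z" by (simp add: lo_iff)
      with t have "?z \<notin> lo t" by auto
      then have "inv u ?z < inv u t"
        using * t1 z by (intro not_lo_imp_before) auto
      with inv_u_range[of t] t1 show False by auto
    qed
    then show ?thesis
      using lo_closed by (auto simp: dominated_def)
  qed
  have "card {t \<in> rows. lo t \<subseteq> lo ?z} = card (rows \<inter> lo ?z) + card (rows \<inter> {?z}) + card (dominated ?z)"
    unfolding eq using finite_rows finite_dominated
    by (subst card_Un_disjoint, simp, simp, force simp: dominated_def lo_iff)
      (subst card_Un_disjoint, auto simp: lo_iff)
  then show ?thesis
    using sum_wt_lo_inter[of ?z ?z]
    by (auto simp: outflow_def inflow_def bef algebra_simps)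
qed

text \<open>After the common part of the two prefixes has cancelled, an identity between numbers of
  rows is left. Both sides count the rows \<open>t \<le> x\<close> with
  \<open>lo t \<subseteq> lo x\<close> and \<open>t \<notin> lo y\<close>.\<close>

lemma gap_value_static:
  assumes k: "1 \<le> k" "k < n" and asc: "u k < u (Suc k)" and D: "u k \<notin> lo (u (Suc k))"
  shows "gap_value u k = 0"
proof -
  define x where "x = u k"
  define y where "y = u (Suc k)"
  have x: "x \<in> {1..n}" "inv u x = k" and y: "y \<in> {1..n}" "inv u y = Suc k"
    using k u_range[of k] u_range[of "Suc k"] by (auto simp: x_def y_def)
  have xy: "x < y" "x \<notin> lo y" using asc D by (auto simp: x_def y_def)
  have wxy: "inv w x < inv w y"
    using xy x y inv_w_inj[of x y] by (auto simp: lo_iff)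
  \<comment> \<open>A letter violating this would stand strictly between two neighbours.\<close>
  have between: "z \<in> lo y \<or> x \<in> lo z" if "x < z" "z < y" for z
  proof (rule ccontr)
    assume *: "\<not> ?thesis"
    have "inv u x < inv u z"
      using * x y that by (intro not_lo_imp_before) auto
    moreover have "inv u z < inv u y"
      using * x y that by (intro not_lo_imp_before) auto
    ultimately show False using x y by auto
  qed
  have lo_y_x: "z \<in> lo x" if "z \<in> lo y" "z < x" for z
    using that wxy x y by (auto simp: lo_iff)
  have bef_y: "before u y = insert x (before u x)"
  proof -
    have "inv u z = k \<longleftrightarrow> z = x" for z
      using x(2) inv_u_inj[of z x] by simp
    then show ?thesis
      using x(1) unfolding before_def x(2) y(2) less_Suc_eq by blast
  qed
  \<comment> \<open>Letters of \<open>lo x\<close> outside \<open>lo y\<close> are not inverted with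
    \<open>y\<close>, so they precede \<open>y\<close>, and therefore also its left neighbour
    \<open>x\<close>.\<close>
  have A1: "before u x \<inter> lo x = (lo x - lo y) \<union> (before u x \<inter> (lo x \<inter> lo y))"
  proof -
    have "z \<in> before u x" if "z \<in> lo x" "z \<notin> lo y" for z
    proof -
      have "z \<in> {1..n}" "z < x" using that by (auto simp: lo_iff)
      then have "inv u z < inv u y" using that xy y by (intro not_lo_imp_before) auto
      moreover have "inv u z \<noteq> k" using x(2) inv_u_inj[of z x] \<open>z < x\<close> by (metis less_irrefl)
      ultimately show ?thesis using \<open>z \<in> {1..n}\<close> x y by (auto simp: before_def)
    qed
    then show ?thesis by auto
  qed
  have A2: "before u y \<inter> lo y = before u x \<inter> (lo x \<inter> lo y)"
  proof -
    have "z \<in> lo x" if "z \<in> before u x" "z \<in> lo y" for z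
    proof (cases "z < x")
      case True then show ?thesis using lo_y_x that by auto
    next
      case False
      then have "x < z" using that by (cases "z = x") (auto simp: before_def)
      moreover have "z \<le> n" "x \<notin> lo z" using that wxy y by (auto simp: lo_iff)
      ultimately have "inv u x < inv u z" using x by (intro not_lo_imp_before) auto
      with that show ?thesis by (auto simp: before_def)
    qed
    then show ?thesis using xy bef_y by auto
  qed
  have s1: "sum wt (before u x \<inter> lo x) = sum wt (lo x - lo y) + sum wt (before u x \<inter> (lo x \<inter> lo y))"
    unfolding A1 by (subst sum.union_disjoint) (auto simp: finite_lo)
  have s2: "sum wt (lo x) = sum wt (lo x - lo y) + sum wt (lo x \<inter> lo y)"
    using sum.union_disjoint[of "lo x - lo y" "lo x \<inter> lo y" wt] finite_lo[of x]
    by (auto simp: Un_Diff_Int)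
  have s3: "sum wt (before u y \<inter> lo y) = sum wt (before u x \<inter> (lo x \<inter> lo y))"
    using A2 by simp
  let ?L1 = "{t \<in> rows. lo t \<subseteq> lo x \<and> \<not> lo t \<subseteq> lo y}"
  let ?L2 = "dominated y"
  let ?R = "dominated x \<union> (rows \<inter> {x}) \<union> (rows \<inter> (lo x - lo y))"
  have R: "?R = {t \<in> rows. t \<le> x \<and> lo t \<subseteq> lo x \<and> t \<notin> lo y}"
    proof -
    have "t < x" if "t \<in> lo x" for t using that by (simp add: lo_iff)
    then show ?thesis
      using lo_closed[of _ x] xy lo_y_x by (auto simp: dominated_def le_less)
  qed
  have eq: "?L1 \<union> ?L2 = ?R"
  proof -
    \<comment> \<open>Otherwise a column \<open>z\<close> of \<open>t\<close> outside
      \<open>lo y\<close> puts \<open>t\<close> between \<open>x\<close> and \<open>y\<close> in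
      \<open>w\<close>, by position and by value. Then \<open>between\<close> places
      \<open>t\<close> in \<open>lo y\<close>, although \<open>t\<close> precedes \<open>y\<close>
      in \<open>w\<close>.\<close>
    have 1: "t \<le> x" if t: "t \<in> rows" "lo t \<subseteq> lo x" "\<not> lo t \<subseteq> lo y" for t
    proof (rule ccontr)
      assume "\<not> t \<le> x"
      then have tx: "x < t" by simp
      have tn: "t \<in> {1..n}" using t rows_subset by auto
      have "x \<notin> lo x" by (simp add: lo_iff)
      then have xt: "x \<notin> lo t" using t by auto
      then have wxt: "inv w x < inv w t" using tx tn x inv_w_inj[of x t] by (auto simp: lo_iff)
      obtain z where z: "z \<in> lo t" "z \<notin> lo y" using t by auto
      then have zx: "z \<in> lo x" using t by auto
      have "inv w z < inv w y" using z zx xy x y inv_w_inj[of z y] by (auto simp: lo_iff)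
      then have wty: "inv w t < inv w y" using z by (auto simp: lo_iff)
      have "t \<noteq> y" using z by auto
      moreover have "\<not> y < t"
      proof
        assume "y < t"
        then have "y \<in> lo t" using wty tn y by (auto simp: lo_iff)
        then have "y \<in> lo x" using t by auto
        then show False using xy by (auto simp: lo_iff)
      qed
      ultimately have "t < y" by auto
      with between[of t] tx xt have "t \<in> lo y" by auto
      then show False using wty by (auto simp: lo_iff)
    qed
    have 2: "t \<notin> lo y" if "lo t \<subseteq> lo x" "\<not> lo t \<subseteq> lo y" for t
      using lo_closed that by auto
    have 3: "t \<le> x \<and> lo t \<subseteq> lo x" if t: "t \<in> rows" "t < y" "t \<notin> lo y" "lo t \<subseteq> lo y" for t
    proof -
      have "x \<notin> lo t" using t xy by auto
      then have le: "t \<le> x" using between[of t] t by (metis linorder_not_le)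
      have "z \<in> lo x" if "z \<in> lo t" for z
      proof -
        have "z < t" using that by (simp add: lo_iff)
        then show ?thesis using that t(4) lo_y_x[of z] le by auto
      qed
      with le show ?thesis by auto
    qed
    have 4: "t < y" if "t \<le> x" for t using that xy by auto
    show ?thesis
      unfolding R
    proof (intro equalityI subsetI)
      fix t assume t: "t \<in> ?L1 \<union> ?L2"
      show "t \<in> {t \<in> rows. t \<le> x \<and> lo t \<subseteq> lo x \<and> t \<notin> lo y}"
      proof (cases "t \<in> ?L1")
        case True
        then show ?thesis using 1[of t] 2[of t] by simp
      next
        case False
        then have "t \<in> ?L2" using t by blast
        then show ?thesis using 3[of t] by (simp add: dominated_def)
      qed
    next
      fix t assume "t \<in> {t \<in> rows. t \<le> x \<and> lo t \<subseteq> lo x \<and> t \<notin> lo y}"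
      then show "t \<in> ?L1 \<union> ?L2" using 4[of t] by (simp add: dominated_def)
    qed
  qed
  have "card ?L1 + card ?L2 = card (?L1 \<union> ?L2)"
    using finite_rows finite_dominated by (subst card_Un_disjoint) (auto simp: dominated_def)
  also have "\<dots> = card (dominated x) + card (rows \<inter> {x}) + card (rows \<inter> (lo x - lo y))"
    unfolding eq using finite_rows finite_dominated
    by (subst card_Un_disjoint, simp, simp, force simp: dominated_def lo_iff)
      (subst card_Un_disjoint, auto simp: dominated_def)
  finally have c1: "card ?L1 + card ?L2 =
    card (dominated x) + card (rows \<inter> {x}) + card (rows \<inter> (lo x - lo y))" .
  have c2: "card {t \<in> rows. lo t \<subseteq> lo x} = card ?L1 + card {t \<in> rows. lo t \<subseteq> lo x \<inter> lo y}"
    using finite_rows by (subst card_Un_disjoint[symmetric]) (auto intro!: arg_cong[where f = card])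
  have c3: "card (rows \<inter> lo x) = card (rows \<inter> (lo x - lo y)) + card (rows \<inter> (lo x \<inter> lo y))"
    using finite_rows by (subst card_Un_disjoint[symmetric]) (auto intro!: arg_cong[where f = card])
  have "sum wt (lo x - lo y) = int (card cols) *
      (int (card (rows \<inter> (lo x - lo y))) - int (card ?L1))"
    using s2 sum_wt_lo_inter[of x x] sum_wt_lo_inter[of x y] c2 c3 by (simp add: algebra_simps)
  also have "int (card (rows \<inter> (lo x - lo y))) - int (card ?L1) =
      int (card ?L2) - int (card (dominated x)) - int (card (rows \<inter> {x}))"
    using c1 by linarith
  finally show ?thesis
    unfolding gap_value_def x_def[symmetric] y_def[symmetric] outflow_def inflow_def s1 s3
    by (auto simp: algebra_simps)
qed

lemma sum_gap_value:
  assumes "1 \<le> n"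
  shows "(\<Sum>k=1..<n. gap_value u k) = int (card rows) * int (card cols)"
  using assms by (intro gap_sum inflow_first outflow_last)

end

section \<open>Toggles on maximal chains\<close>

text \<open>In a graded poset a chain is maximal once it has the right size, so the maximality of a
  modified chain becomes a matter of counting.\<close>

definition graded_maxchains :: "'a set \<Rightarrow> ('a \<Rightarrow> 'a \<Rightarrow> bool) \<Rightarrow> nat \<Rightarrow> 'a set set" where
  "graded_maxchains P le N =
     {C. C \<subseteq> P \<and> (\<forall>x\<in>C. \<forall>y\<in>C. le x y \<or> le y x) \<and> card C = N}"

text \<open>The exchange in abstract form: \<open>low\<close> means that the pair is not yet
  inverted, \<open>\<tau>\<close> exchanges its values, and \<open>A\<close> and \<open>B\<close>
  are the lower and upper ends of the edges with one label. Good behaviour of \<open>\<tau>\<close>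
  is demanded only between two elements of \<open>A\<close> or two of \<open>B\<close>, since
  outside such ranges it may leave \<open>P\<close>.\<close>

locale toggle =
  fixes P :: "'a set" and le :: "'a \<Rightarrow> 'a \<Rightarrow> bool" and N :: nat
    and low :: "'a \<Rightarrow> bool" and \<tau> :: "'a \<Rightarrow> 'a" and A B :: "'a set"
  assumes finite_P: "finite P"
    and le_refl: "x \<in> P \<Longrightarrow> le x x"
    and le_antisym: "x \<in> P \<Longrightarrow> y \<in> P \<Longrightarrow> le x y \<Longrightarrow> le y x \<Longrightarrow> x = y"
    and le_trans: "le x y \<Longrightarrow> le y z \<Longrightarrow> le x z"
    and low_down: "le x y \<Longrightarrow> low y \<Longrightarrow> low x"
    and \<tau>_invol: "\<tau> (\<tau> x) = x"
    and A_D: "u \<in> A \<Longrightarrow> u \<in> P \<and> low u \<and> \<tau> u \<in> B \<and> le u (\<tau> u)"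
    and B_D: "u \<in> B \<Longrightarrow> u \<in> P \<and> \<not> low u \<and> \<tau> u \<in> A"
    and interval_A: "u \<in> A \<Longrightarrow> v \<in> A \<Longrightarrow> c \<in> P \<Longrightarrow> le u c \<Longrightarrow> le c v \<Longrightarrow> \<tau> c \<in> P \<and> \<not> low (\<tau> c)"
    and mono_A: "u \<in> A \<Longrightarrow> v \<in> A \<Longrightarrow> c \<in> P \<Longrightarrow> d \<in> P \<Longrightarrow> le u c \<Longrightarrow> le c d \<Longrightarrow> le d v \<Longrightarrow> le (\<tau> c) (\<tau> d)"
    and interval_B: "u \<in> B \<Longrightarrow> v \<in> B \<Longrightarrow> c \<in> P \<Longrightarrow> le u c \<Longrightarrow> le c v \<Longrightarrow> \<tau> c \<in> P \<and> low (\<tau> c)"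
    and mono_B: "u \<in> B \<Longrightarrow> v \<in> B \<Longrightarrow> c \<in> P \<Longrightarrow> d \<in> P \<Longrightarrow> le u c \<Longrightarrow> le c d \<Longrightarrow> le d v \<Longrightarrow> le (\<tau> c) (\<tau> d)"
    and crossing: "C \<in> graded_maxchains P le N \<Longrightarrow> C \<inter> (A \<union> B) \<noteq> {} \<Longrightarrow>
      \<exists>v\<in>A. v \<in> C \<and> \<tau> v \<in> C \<and> (\<forall>c\<in>C. low c \<longrightarrow> le c v) \<and> (\<forall>c\<in>C. \<not> low c \<longrightarrow> le (\<tau> v) c)"
begin

definition crossing_pair :: "'a set \<Rightarrow> 'a \<Rightarrow> bool" where
  "crossing_pair C v \<longleftrightarrow> v \<in> A \<and> v \<in> C \<and> \<tau> v \<in> C \<and> (\<forall>c\<in>C. low c \<longrightarrow> le c v) \<and> (\<forall>c\<in>C. \<not> low c \<longrightarrow> le (\<tau> v) c)"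

lemma crossing_pair_unique:
  assumes "C \<subseteq> P" "crossing_pair C v" "crossing_pair C v'"
  shows "v = v'"
  using assms A_D unfolding crossing_pair_def by (intro le_antisym) auto

definition cross :: "'a set \<Rightarrow> 'a" where
  "cross C = (THE v. crossing_pair C v)"

lemma cross_eq:
  assumes "C \<subseteq> P" "crossing_pair C v"
  shows "cross C = v"
  unfolding cross_def using assms crossing_pair_unique by blast

text \<open>The chain is cut at \<open>u\<close> and its part up to the crossing is moved by \<open>\<tau>\<close>; the old crossing then
  becomes the mark, and the old mark the crossing.\<close>

definition shift :: "'a set \<Rightarrow> 'a \<Rightarrow> 'a set" where
  "shift C u = {c \<in> C. le c u} \<union> \<tau> ` {c \<in> C. low c \<and> le u c} \<union> {c \<in> C. \<not> low c}"

text \<open>With \<open>v\<close> the crossing, the moved part hangs on the edge from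
  \<open>u\<close> to \<open>\<tau> u\<close> below and joins the old chain in
  \<open>\<tau> v\<close> above. The last two claims recover \<open>C\<close> and \<open>u\<close>
  from the new marked chain, which yields injectivity.\<close>

lemma shift:
  assumes C: "C \<in> graded_maxchains P le N" and u: "u \<in> C" "u \<in> A"
  shows "shift C u \<in> graded_maxchains P le N" (is ?chain)
    and "\<tau> (cross C) \<in> shift C u \<inter> B"
    and "C = {c \<in> shift C u. low c} \<union> \<tau> ` {c \<in> shift C u. \<not> low c \<and> le c (\<tau> (cross C))}
      \<union> {c \<in> shift C u. le (\<tau> (cross C)) c}"
    and "u = cross (shift C u)"
proof -
  have CP: "C \<subseteq> P" and cmp: "\<And>x y. x \<in> C \<Longrightarrow> y \<in> C \<Longrightarrow> le x y \<or> le y x" and card: "card C = N"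
    using C by (auto simp: graded_maxchains_def)
  have finC: "finite C" using CP finite_P by (rule finite_subset)
  obtain v where v: "crossing_pair C v"
    using crossing[OF C] u unfolding crossing_pair_def by blast
  then have vA: "v \<in> A" "v \<in> C" "\<tau> v \<in> C"
    and v_max: "\<And>c. c \<in> C \<Longrightarrow> low c \<Longrightarrow> le c v"
    and v_min: "\<And>c. c \<in> C \<Longrightarrow> \<not> low c \<Longrightarrow> le (\<tau> v) c"
    by (auto simp: crossing_pair_def)
  have cross: "cross C = v" using cross_eq[OF CP v] .
  let ?M = "{c \<in> C. low c \<and> le u c}"
  let ?D = "{c \<in> C. le c u}"
  let ?U = "{c \<in> C. \<not> low c}"
  have uP: "u \<in> P" "low u" "\<tau> u \<in> B" "le u (\<tau> u)" and vP: "v \<in> P" "low v" "\<tau> v \<in> B"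
    using A_D u vA by auto
  have M: "c \<in> P" "le u c" "le c v" "\<tau> c \<in> P" "\<not> low (\<tau> c)" "le (\<tau> u) (\<tau> c)" "le (\<tau> c) (\<tau> v)"
    if "c \<in> ?M" for c
  proof -
    show c: "c \<in> P" "le u c" "le c v" using that CP v_max by auto
    show "\<tau> c \<in> P" "\<not> low (\<tau> c)" using interval_A[OF u(2) vA(1) c] by auto
    show "le (\<tau> u) (\<tau> c)"
      by (rule mono_A[OF u(2) vA(1) uP(1) c(1) le_refl[OF uP(1)] c(2,3)])
    show "le (\<tau> c) (\<tau> v)"
      by (rule mono_A[OF u(2) vA(1) c(1) vP(1) c(2,3) le_refl[OF vP(1)]])
  qed
  have D_low: "low c" if "c \<in> ?D" for c using that low_down uP by auto
  have inj: "inj \<tau>" using \<tau>_invol by (metis injI)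
  have MU: "\<tau> ` ?M \<inter> ?U = {\<tau> v}"
  proof
    show "{\<tau> v} \<subseteq> \<tau> ` ?M \<inter> ?U"
      using vA vP(2,3) u uP(2) v_max[of v] v_max[of u] B_D[OF vP(3)] le_refl[OF vP(1)] by auto
    show "\<tau> ` ?M \<inter> ?U \<subseteq> {\<tau> v}"
    proof
      fix x assume "x \<in> \<tau> ` ?M \<inter> ?U"
      then obtain c where c: "c \<in> ?M" "x = \<tau> c" "x \<in> ?U" by auto
      then have "le (\<tau> v) x" "le x (\<tau> v)" using v_min[of x] M(7)[of c] by auto
      then show "x \<in> {\<tau> v}" using le_antisym[of x "\<tau> v"] c CP vA by auto
    qed
  qed
  have DM: "?D \<inter> ?M = {u}"
  proof -
    have "c = u" if "c \<in> ?D" "c \<in> ?M" for c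
      using that le_antisym[of c u] CP uP by auto
    moreover have "u \<in> ?D" "u \<in> ?M" using u uP le_refl[of u] by auto
    ultimately show ?thesis by blast
  qed
  \<comment> \<open>The three pieces of \<open>C\<close> overlap only in \<open>u\<close>, those of
    \<open>shift C u\<close> only in \<open>\<tau> v\<close>, so the sizes agree.\<close>
  have e1: "card (shift C u) = card ?D + card (\<tau> ` ?M \<union> ?U)"
  proof -
    have "?D \<inter> (\<tau> ` ?M \<union> ?U) = {}" using D_low M(5) by blast
    then show ?thesis unfolding shift_def Un_assoc using finC by (intro card_Un_disjoint) auto
  qed
  have e2: "card (\<tau> ` ?M \<union> ?U) + 1 = card (\<tau> ` ?M) + card ?U"
    using card_Un_Int[of "\<tau> ` ?M" ?U] finC MU by auto
  have e3: "card (\<tau> ` ?M) = card ?M"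
    by (rule card_image) (rule inj_on_subset[OF inj], simp)
  have e4: "card (?D \<union> ?M) + 1 = card ?D + card ?M"
    using card_Un_Int[of ?D ?M] finC DM by auto
  have e5: "card ((?D \<union> ?M) \<union> ?U) = card (?D \<union> ?M) + card ?U"
  proof -
    have "(?D \<union> ?M) \<inter> ?U = {}" using D_low by blast
    then show ?thesis using finC by (intro card_Un_disjoint) auto
  qed
  have e6: "(?D \<union> ?M) \<union> ?U = C"
    using cmp u by blast
  have "card C + 1 + 1 = card ?D + card ?M + card ?U + 1"
    using e4 e5 unfolding e6 by simp
  then have card': "card (shift C u) = N" using card e1 e2 e3 by simp
  have sub: "shift C u \<subseteq> P"
    using CP M(4) unfolding shift_def by blast
  have mem: "\<And>x. x \<in> shift C u \<Longrightarrow> x \<in> ?D \<or> (\<exists>c\<in>?M. x = \<tau> c) \<or> x \<in> ?U"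
    unfolding shift_def by blast
  have D_\<tau>: "le x (\<tau> c)" if "x \<in> ?D" "c \<in> ?M" for x c
    using that M(6)[of c] uP le_trans[of x u "\<tau> c"] le_trans[of u "\<tau> u" "\<tau> c"] by blast
  have \<tau>_U: "le (\<tau> c) x" if "x \<in> ?U" "c \<in> ?M" for x c
    using that M(7)[of c] v_min[of x] le_trans[of "\<tau> c" "\<tau> v" x] by blast
  have \<tau>_\<tau>: "le (\<tau> c) (\<tau> d) \<or> le (\<tau> d) (\<tau> c)" if "c \<in> ?M" "d \<in> ?M" for c d
    using cmp[of c d] mono_A[OF u(2) vA(1), of c d] mono_A[OF u(2) vA(1), of d c]
      M(1-3)[OF that(1)] M(1-3)[OF that(2)] that by blast
  have "le x y \<or> le y x" if xy: "x \<in> shift C u" "y \<in> shift C u" for x y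
  proof -
    have DU: "le x y \<or> le y x" if "x \<in> ?D \<union> ?U" "y \<in> ?D \<union> ?U" for x y
      using cmp[of x y] that by blast
    consider "x \<in> ?D \<union> ?U" "y \<in> ?D \<union> ?U" | c where "c \<in> ?M" "x = \<tau> c" "y \<in> ?D \<union> ?U"
      | d where "d \<in> ?M" "y = \<tau> d" "x \<in> ?D \<union> ?U" | c d where "c \<in> ?M" "d \<in> ?M" "x = \<tau> c" "y = \<tau> d"
      using mem[OF xy(1)] mem[OF xy(2)] by blast
    then show ?thesis
    proof cases
      case 1 then show ?thesis by (rule DU)
    next
      case 2 then show ?thesis using D_\<tau>[of y c] \<tau>_U[of y c] by blast
    next
      case 3 then show ?thesis using D_\<tau>[of x d] \<tau>_U[of x d] by blast
    next
      case 4 then show ?thesis using \<tau>_\<tau>[of c d] by simp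
    qed
  qed
  then show chain': ?chain using sub card' by (auto simp: graded_maxchains_def)
  show "\<tau> (cross C) \<in> shift C u \<inter> B"
    using vA vP B_D by (auto simp: cross shift_def)
  have low': "{c \<in> shift C u. low c} = ?D"
    using D_low M(5) unfolding shift_def by blast
  have up1: "{c \<in> shift C u. \<not> low c \<and> le c (\<tau> v)} = \<tau> ` ?M"
  proof
    have "x \<in> \<tau> ` ?M" if "x \<in> ?U" "le x (\<tau> v)" for x
    proof -
      have "x = \<tau> v" using that v_min[of x] le_antisym[of x "\<tau> v"] CP vA by blast
      then show ?thesis using MU by blast
    qed
    then show "{c \<in> shift C u. \<not> low c \<and> le c (\<tau> v)} \<subseteq> \<tau> ` ?M"
      using D_low unfolding shift_def by blast
    show "\<tau> ` ?M \<subseteq> {c \<in> shift C u. \<not> low c \<and> le c (\<tau> v)}"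
      using M(5,7) by (fastforce simp: shift_def)
  qed
  have up2: "{c \<in> shift C u. le (\<tau> v) c} = ?U"
  proof
    have "\<tau> c \<in> ?U" if "c \<in> ?M" "le (\<tau> v) (\<tau> c)" for c
    proof -
      have "\<tau> c = \<tau> v" using that M(4,7)[of c] le_antisym[of "\<tau> c" "\<tau> v"] CP vA by blast
      then show ?thesis using MU by blast
    qed
    moreover have False if "x \<in> ?D" "le (\<tau> v) x" for x
      using that D_low[of x] low_down[of "\<tau> v" x] B_D[OF vP(3)] by blast
    ultimately show "{c \<in> shift C u. le (\<tau> v) c} \<subseteq> ?U"
      unfolding shift_def by blast
    show "?U \<subseteq> {c \<in> shift C u. le (\<tau> v) c}"
      using v_min by (auto simp: shift_def)
  qed
  have "\<tau> ` \<tau> ` ?M = ?M" by (simp add: image_image \<tau>_invol)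
  then show "C = {c \<in> shift C u. low c} \<union> \<tau> ` {c \<in> shift C u. \<not> low c \<and> le c (\<tau> (cross C))}
      \<union> {c \<in> shift C u. le (\<tau> (cross C)) c}"
    unfolding cross low' up1 up2 using e6 by simp
  have "crossing_pair (shift C u) u"
    unfolding crossing_pair_def
  proof (intro conjI ballI impI)
    show "u \<in> A" by fact
    show "u \<in> shift C u" using u le_refl uP by (auto simp: shift_def)
    have "u \<in> ?M" using u le_refl uP by auto
    then show "\<tau> u \<in> shift C u" by (auto simp: shift_def)
    fix c assume c: "c \<in> shift C u"
    show "le c u" if "low c" using that c low' by blast
    show "le (\<tau> u) c" if "\<not> low c"
      using mem[OF c] that D_low[of c] M(6) \<tau>_U[of c u] \<open>u \<in> ?M\<close> by blast
  qed
  then show "u = cross (shift C u)" using cross_eq sub by simp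
qed

lemma card_marked_chains_le:
  "card {(C, u). C \<in> graded_maxchains P le N \<and> u \<in> C \<inter> A} \<le>
   card {(C, u). C \<in> graded_maxchains P le N \<and> u \<in> C \<inter> B}"
proof (rule card_inj_on_le)
  let ?f = "\<lambda>(C, u). (shift C u, \<tau> (cross C))"
  show "?f ` {(C, u). C \<in> graded_maxchains P le N \<and> u \<in> C \<inter> A} \<subseteq>
    {(C, u). C \<in> graded_maxchains P le N \<and> u \<in> C \<inter> B}"
    using shift(1,2) by auto
  show "inj_on ?f {(C, u). C \<in> graded_maxchains P le N \<and> u \<in> C \<inter> A}"
  proof (rule inj_onI, clarsimp)
    fix C u C' u'
    assume *: "C \<in> graded_maxchains P le N" "u \<in> C" "u \<in> A"
      "C' \<in> graded_maxchains P le N" "u' \<in> C'" "u' \<in> A"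
      and eq: "shift C u = shift C' u'" "\<tau> (cross C) = \<tau> (cross C')"
    have "C = C'" using shift(3)[OF *(1-3)] shift(3)[OF *(4-6)] unfolding eq by simp
    moreover have "u = u'" using shift(4)[OF *(1-3)] shift(4)[OF *(4-6)] eq by simp
    ultimately show "C = C' \<and> u = u'" by simp
  qed
  have "{(C, u). C \<in> graded_maxchains P le N \<and> u \<in> C \<inter> B} \<subseteq> Pow P \<times> P"
    by (auto simp: graded_maxchains_def)
  then show "finite {(C, u). C \<in> graded_maxchains P le N \<and> u \<in> C \<inter> B}"
    by (rule finite_subset) (simp add: finite_P)
qed

text \<open>Reversing the order exchanges lower and upper ends, so the opposite inequality comes
  from the same injection.\<close>

lemma dual: "toggle P (\<lambda>x y. le y x) N (\<lambda>x. \<not> low x) \<tau> B A"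
proof
  have gm: "graded_maxchains P (\<lambda>x y. le y x) N = graded_maxchains P le N"
    unfolding graded_maxchains_def by blast
  show "\<exists>v\<in>B. v \<in> C \<and> \<tau> v \<in> C \<and> (\<forall>c\<in>C. \<not> low c \<longrightarrow> le v c) \<and> (\<forall>c\<in>C. \<not> \<not> low c \<longrightarrow> le c (\<tau> v))"
    if C: "C \<in> graded_maxchains P (\<lambda>x y. le y x) N" "C \<inter> (B \<union> A) \<noteq> {}" for C
  proof -
    obtain v where "v \<in> A" "v \<in> C" "\<tau> v \<in> C" "\<forall>c\<in>C. low c \<longrightarrow> le c v" "\<forall>c\<in>C. \<not> low c \<longrightarrow> le (\<tau> v) c"
      using crossing[of C] C unfolding gm by blast
    then show ?thesis using A_D \<tau>_invol by (intro bexI[of _ "\<tau> v"]) auto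
  qed
  show "u \<in> P \<and> \<not> low u \<and> \<tau> u \<in> A \<and> le (\<tau> u) u" if "u \<in> B" for u
    using B_D[OF that] A_D[of "\<tau> u"] \<tau>_invol by auto
  show "u \<in> P \<and> \<not> \<not> low u \<and> \<tau> u \<in> B" if "u \<in> A" for u
    using A_D[OF that] by simp
  show "\<tau> c \<in> P \<and> \<not> \<not> low (\<tau> c)" if "u \<in> B" "v \<in> B" "c \<in> P" "le c u" "le v c" for u v c
    using interval_B[of v u c] that by simp
  show "\<tau> c \<in> P \<and> \<not> low (\<tau> c)" if "u \<in> A" "v \<in> A" "c \<in> P" "le c u" "le v c" for u v c
    using interval_A[of v u c] that by simp
  show "le (\<tau> d) (\<tau> c)" if "u \<in> B" "v \<in> B" "c \<in> P" "d \<in> P" "le c u" "le d c" "le v d" for u v c d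
    using mono_B[of v u d c] that by simp
  show "le (\<tau> d) (\<tau> c)" if "u \<in> A" "v \<in> A" "c \<in> P" "d \<in> P" "le c u" "le d c" "le v d" for u v c d
    using mono_A[of v u d c] that by simp
  show "\<not> low x" if "le y x" "\<not> low y" for x y
    using low_down[of y x] that by blast
  show "le z x" if "le y x" "le z y" for x y z
    using le_trans[of z y x] that by blast
qed (fact finite_P le_refl le_antisym \<tau>_invol | (rule le_antisym; assumption))+

lemma card_marked_chains_eq:
  "card {(C, u). C \<in> graded_maxchains P le N \<and> u \<in> C \<inter> A} =
   card {(C, u). C \<in> graded_maxchains P le N \<and> u \<in> C \<inter> B}"
proof -
  have gm: "graded_maxchains P (\<lambda>x y. le y x) N = graded_maxchains P le N"
    unfolding graded_maxchains_def by blast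
  show ?thesis
    using card_marked_chains_le toggle.card_marked_chains_le[OF dual] unfolding gm by linarith
qed

end

section \<open>The interval as a graded poset\<close>

abbreviation vinv :: "nat \<Rightarrow> (nat \<Rightarrow> nat) \<Rightarrow> (nat \<times> nat) set" where
  "vinv n u \<equiv> Inversions n (inv u)"

abbreviation adj :: "nat \<Rightarrow> nat \<Rightarrow> nat" where
  "adj k \<equiv> Transposition.transpose k (Suc k)"

lemma vinv_iff: "(i, j) \<in> vinv n u \<longleftrightarrow> 1 \<le> i \<and> i < j \<and> j \<le> n \<and> inv u j < inv u i"
  by (auto simp: Inversions_def)

lemma finite_Inversions: "finite (Inversions n u)"
  by (rule finite_subset[of _ "{1..n} \<times> {1..n}"]) (auto simp: Inversions_def)

lemma permutes_inv_eq_iff: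
  assumes "u permutes S" shows "inv u x = inv u y \<longleftrightarrow> x = y"
  using permutes_inj[OF permutes_inv[OF assms]] by (auto dest: injD)

lemma permutes_inv_apply:
  assumes "u permutes S" shows "inv u (u k) = k" "u (inv u x) = x"
  using permutes_inverses[OF assms] by auto

lemma inv_comp_transpose:
  assumes "u permutes S"
  shows "inv (u \<circ> Transposition.transpose k l) x = Transposition.transpose k l (inv u x)"
proof -
  have "inv (u \<circ> Transposition.transpose k l) = inv (Transposition.transpose k l) \<circ> inv u"
    by (rule o_inv_distrib) (auto intro: permutes_bij[OF assms])
  then show ?thesis by simp
qed

lemma permutes_comp_adj:
  assumes "u permutes {1..n}" "1 \<le> k" "k < n"
  shows "u \<circ> adj k permutes {1..n}"
  using assms by (intro permutes_compose permutes_swap_id) auto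

lemma adj_less_iff:
  assumes "p \<noteq> q"
  shows "adj k q < adj k p \<longleftrightarrow> (q < p \<and> \<not> (q = k \<and> p = Suc k)) \<or> (p = k \<and> q = Suc k)"
  using assms by (auto simp: Transposition.transpose_def)

lemma vinv_ascent:
  assumes u: "u permutes {1..n}" and k: "1 \<le> k" "k < n" and asc: "u k < u (Suc k)"
  shows "vinv n (u \<circ> adj k) = insert (u k, u (Suc k)) (vinv n u)" "(u k, u (Suc k)) \<notin> vinv n u"
proof -
  have u_eq: "inv u x = l \<longleftrightarrow> x = u l" for x l
    using permutes_inv_apply[OF u] by metis
  have "u k \<in> {1..n}" "u (Suc k) \<in> {1..n}"
    using permutes_in_image[OF u] k by auto
  note range = this
  show "vinv n (u \<circ> adj k) = insert (u k, u (Suc k)) (vinv n u)"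
  proof (rule set_eqI, unfold split_paired_all)
    fix i j
    have "adj k (inv u j) < adj k (inv u i) \<longleftrightarrow> inv u j < inv u i \<or> i = u k \<and> j = u (Suc k)"
      if "i < j"
    proof -
      have "inv u i \<noteq> inv u j" using that permutes_inv_eq_iff[OF u, of i j] by simp
      then show ?thesis
        using adj_less_iff[of "inv u i" "inv u j" k] asc that
          u_eq[of i k] u_eq[of j k] u_eq[of i "Suc k"] u_eq[of j "Suc k"] by auto
    qed
    then show "(i, j) \<in> vinv n (u \<circ> adj k) \<longleftrightarrow> (i, j) \<in> insert (u k, u (Suc k)) (vinv n u)"
      unfolding vinv_iff inv_comp_transpose[OF u] insert_iff prod.inject using asc range by auto
  qed
  show "(u k, u (Suc k)) \<notin> vinv n u"
    by (simp add: vinv_iff permutes_inv_apply[OF u])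
qed

lemma comp_adj_adj [simp]: "u \<circ> adj k \<circ> adj k = u"
  by (simp add: o_assoc[symmetric])

lemma comp_adj_apply [simp]: "(u \<circ> adj k) k = u (Suc k)" "(u \<circ> adj k) (Suc k) = u k"
  by simp_all

lemma vinv_descent:
  assumes u: "u permutes {1..n}" and k: "1 \<le> k" "k < n" and desc: "u (Suc k) < u k"
  shows "vinv n u = insert (u (Suc k), u k) (vinv n (u \<circ> adj k))" "(u (Suc k), u k) \<notin> vinv n (u \<circ> adj k)"
  using vinv_ascent[OF permutes_comp_adj[OF u k] k] desc by (simp_all add: o_assoc[symmetric])

text \<open>The permutation \<open>inv v \<circ> u\<close> is increasing, so it maps no
  \<open>k\<close> below itself, and on a finite initial segment this leaves only the
  identity.\<close>

lemma permutes_eqI: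
  assumes u: "u permutes {1..n}" and v: "v permutes {1..n}"
    and mono: "\<And>k. 1 \<le> k \<Longrightarrow> k < n \<Longrightarrow> inv v (u k) < inv v (u (Suc k))"
  shows "u = v"
proof -
  have h: "inv v \<circ> u permutes {1..n}"
    using u permutes_inv[OF v] by (rule permutes_compose)
  have "k \<le> inv v (u k)" if "k \<in> {1..n}" for k
    using that
  proof (induction k)
    case (Suc k)
    show ?case
    proof (cases "k = 0")
      case True
      then show ?thesis using permutes_in_image[OF h, of 1] Suc.prems by auto
    next
      case False
      then show ?thesis using Suc mono[of k] by auto
    qed
  qed simp
  then have "inv v \<circ> u = id"
    by (intro permutes_natset_ge[OF h]) auto
  then have "v \<circ> (inv v \<circ> u) = v" by simp
  then show ?thesis
    using permutes_inv_o(1)[OF v] by (simp add: o_assoc)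
qed

text \<open>If there were no such ascent, \<open>inv v\<close> would increase along the word
  \<open>u\<close>: at ascents by assumption, and at descents because inversions of \<open>u\<close>
  are inversions of \<open>v\<close>.\<close>

lemma ex_ascent:
  assumes u: "u permutes {1..n}" and v: "v permutes {1..n}"
    and le: "vinv n u \<subseteq> vinv n v" and "u \<noteq> v"
  shows "\<exists>k. 1 \<le> k \<and> k < n \<and> u k < u (Suc k) \<and> (u k, u (Suc k)) \<in> vinv n v"
proof (rule ccontr)
  assume *: "\<not> ?thesis"
  have "inv v (u k) < inv v (u (Suc k))" if k: "1 \<le> k" "k < n" for k
  proof -
    have r: "u k \<in> {1..n}" "u (Suc k) \<in> {1..n}"
      using permutes_in_image[OF u] k by auto
    have ne: "u k \<noteq> u (Suc k)" using permutes_inj[OF u] by (simp add: inj_eq)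
    show ?thesis
    proof (cases "u k < u (Suc k)")
      case True
      then have "(u k, u (Suc k)) \<notin> vinv n v" using * k by auto
      then show ?thesis using True r permutes_inv_eq_iff[OF v, of "u k" "u (Suc k)"]
        by (auto simp: vinv_iff)
    next
      case False
      then have "(u (Suc k), u k) \<in> vinv n u"
        using ne r by (auto simp: vinv_iff permutes_inv_apply[OF u])
      then have "(u (Suc k), u k) \<in> vinv n v" using le by blast
      then show ?thesis by (simp add: vinv_iff)
    qed
  qed
  then show False using permutes_eqI[OF u v] \<open>u \<noteq> v\<close> by blast
qed

lemma vinv_inj:
  assumes "u permutes {1..n}" "v permutes {1..n}" "vinv n u = vinv n v"
  shows "u = v"
proof (rule ccontr)
  assume "u \<noteq> v"
  then obtain k where "1 \<le> k" "k < n" "u k < u (Suc k)" "(u k, u (Suc k)) \<in> vinv n u"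
    using ex_ascent[of u n v] assms by auto
  then show False using vinv_ascent(2)[OF assms(1)] by blast
qed

lemma ex_max_image:
  fixes f :: "'a \<Rightarrow> nat"
  assumes "finite S" "x \<in> S"
  shows "\<exists>c\<in>S. \<forall>x\<in>S. f x \<le> f c"
proof -
  have "Max (f ` S) \<in> f ` S" using assms by (intro Max_in) auto
  then obtain c where "c \<in> S" "f c = Max (f ` S)" by auto
  then show ?thesis using assms by (intro bexI[of _ c]) auto
qed

lemma ex_min_image:
  fixes f :: "'a \<Rightarrow> nat"
  assumes "finite S" "x \<in> S"
  shows "\<exists>c\<in>S. \<forall>x\<in>S. f c \<le> f x"
proof -
  have "Min (f ` S) \<in> f ` S" using assms by (intro Min_in) auto
  then obtain c where "c \<in> S" "f c = Min (f ` S)" by auto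
  then show ?thesis using assms by (intro bexI[of _ c]) auto
qed

section \<open>Covers, levels and maximal chains of the interval\<close>

context inversion_diagram
begin

abbreviation W :: "(nat \<Rightarrow> nat) set" where "W \<equiv> weak_interval n id w"

lemma W_iff: "u \<in> W \<longleftrightarrow> u permutes {1..n} \<and> vinv n u \<subseteq> vinv n w"
  by (auto simp: weak_interval_def weak_le_def Inversions_def)

lemma id_in_W: "id \<in> W" and w_in_W: "w \<in> W"
  using w_permutes permutes_id by (auto simp: W_iff Inversions_def)

lemma finite_W: "finite W"
  by (rule finite_subset[OF _ finite_permutations[of "{1..n}"]]) (auto simp: W_iff)

lemma W_antisym: "u \<in> W \<Longrightarrow> v \<in> W \<Longrightarrow> weak_le n u v \<Longrightarrow> weak_le n v u \<Longrightarrow> u = v"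
  using vinv_inj by (auto simp: W_iff weak_le_def)

lemma W_down: "v \<in> W \<Longrightarrow> u permutes {1..n} \<Longrightarrow> weak_le n u v \<Longrightarrow> u \<in> W"
  by (auto simp: W_iff weak_le_def)

lemma W_ascent:
  assumes "u \<in> W" "1 \<le> k" "k < n" "u k < u (Suc k)" "(u k, u (Suc k)) \<in> vinv n w"
  shows "u \<circ> adj k \<in> W"
  using assms vinv_ascent(1)[of u n k] permutes_comp_adj[of u n k] by (auto simp: W_iff simp del: o_apply)

lemma W_descent:
  assumes "u \<in> W" "1 \<le> k" "k < n" "u (Suc k) < u k"
  shows "u \<circ> adj k \<in> W"
  using assms vinv_descent(1)[of u n k] permutes_comp_adj[of u n k] by (auto simp: W_iff simp del: o_apply)

lemma weak_le_less_card:
  assumes "u \<in> W" "v \<in> W" "weak_le n u v" "u \<noteq> v"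
  shows "card (vinv n u) < card (vinv n v)"
  using assms vinv_inj by (intro psubset_card_mono finite_Inversions) (auto simp: W_iff weak_le_def)

lemma ex_between:
  assumes "u \<in> W" "v \<in> W" "weak_le n u v" "u \<noteq> v"
  obtains k where "1 \<le> k" "k < n" "u k < u (Suc k)" "(u k, u (Suc k)) \<in> vinv n v"
    "u \<circ> adj k \<in> W" "weak_le n u (u \<circ> adj k)" "weak_le n (u \<circ> adj k) v"
    "card (vinv n (u \<circ> adj k)) = Suc (card (vinv n u))"
proof -
  have up: "u permutes {1..n}" and vp: "v permutes {1..n}" and le: "vinv n u \<subseteq> vinv n v" "vinv n v \<subseteq> vinv n w"
    using assms by (auto simp: W_iff weak_le_def)
  obtain k where k: "1 \<le> k" "k < n" "u k < u (Suc k)" "(u k, u (Suc k)) \<in> vinv n v"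
    using ex_ascent[OF up vp le(1) assms(4)] by auto
  note I = vinv_ascent[OF up k(1-3)]
  have "u \<circ> adj k \<in> W" using W_ascent[OF assms(1) k(1-3)] k(4) le by blast
  moreover have "weak_le n u (u \<circ> adj k)" "weak_le n (u \<circ> adj k) v"
    using I k le by (auto simp: weak_le_def)
  moreover have "card (vinv n (u \<circ> adj k)) = Suc (card (vinv n u))"
    unfolding I(1) using I(2) finite_Inversions by simp
  ultimately show ?thesis using that k by blast
qed

lemma covered_by_iff:
  assumes p: "p \<in> W"
  shows "covered_by W (weak_le n) q p \<longleftrightarrow> (\<exists>k. 1 \<le> k \<and> k < n \<and> p (Suc k) < p k \<and> q = p \<circ> adj k)"
proof
  assume c: "covered_by W (weak_le n) q p"
  then have q: "q \<in> W" "weak_le n q p" "q \<noteq> p" by (auto simp: covered_by_def)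
  obtain k where k: "1 \<le> k" "k < n" "q k < q (Suc k)" "q \<circ> adj k \<in> W" "weak_le n q (q \<circ> adj k)"
      "weak_le n (q \<circ> adj k) p" "card (vinv n (q \<circ> adj k)) = Suc (card (vinv n q))"
    using ex_between[OF q(1) p q(2,3)] by blast
  have "q \<circ> adj k \<noteq> q" using k(7) by (auto simp del: o_apply)
  then have "p = q \<circ> adj k" using c k unfolding covered_by_def by blast
  then show "\<exists>k. 1 \<le> k \<and> k < n \<and> p (Suc k) < p k \<and> q = p \<circ> adj k"
    using k by (intro exI[of _ k]) simp
next
  assume "\<exists>k. 1 \<le> k \<and> k < n \<and> p (Suc k) < p k \<and> q = p \<circ> adj k"
  then obtain k where k: "1 \<le> k" "k < n" "p (Suc k) < p k" "q = p \<circ> adj k" by blast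
  have pp: "p permutes {1..n}" using p by (simp add: W_iff)
  note I = vinv_descent[OF pp k(1-3), folded k(4)]
  have q: "q \<in> W" using W_descent[OF p k(1-3)] k by simp
  have "r = q \<or> r = p" if r: "r \<in> W" "weak_le n q r" "weak_le n r p" for r
  proof -
    have "vinv n q \<subseteq> vinv n r" "vinv n r \<subseteq> insert (p (Suc k), p k) (vinv n q)"
      using r I(1) by (simp_all add: weak_le_def)
    then have "vinv n r = vinv n q \<or> vinv n r = vinv n p"
      unfolding I(1) by (cases "(p (Suc k), p k) \<in> vinv n r") blast+
    then show ?thesis using vinv_inj r q p by (auto simp: W_iff)
  qed
  moreover have "q \<noteq> p" using I by auto
  moreover have "weak_le n q p" using I by (auto simp: weak_le_def)
  ultimately show "covered_by W (weak_le n) q p" using q p unfolding covered_by_def by blast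
qed

lemma ddeg_eq:
  assumes p: "p \<in> W"
  shows "ddeg W (weak_le n) p = card {k. 1 \<le> k \<and> k < n \<and> p (Suc k) < p k}"
proof -
  have "inj_on (\<lambda>k. p \<circ> adj k) K" for K
  proof (rule inj_onI)
    fix k l assume "p \<circ> adj k = p \<circ> adj l"
    then have "inv p \<circ> p \<circ> adj k = inv p \<circ> p \<circ> adj l" by (simp add: o_assoc[symmetric])
    then have eq: "adj k = adj l" using permutes_inv_o(2)[of p "{1..n}"] p by (simp add: W_iff)
    have "adj l k = Suc k" using eq transpose_apply_first[of k "Suc k"] by simp
    then show "k = l"
      unfolding Transposition.transpose_def by presburger
  qed
  moreover have "{q. covered_by W (weak_le n) q p} = (\<lambda>k. p \<circ> adj k) ` {k. 1 \<le> k \<and> k < n \<and> p (Suc k) < p k}"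
    using covered_by_iff[OF p] by auto
  ultimately show ?thesis unfolding ddeg_def by (simp add: card_image)
qed

text \<open>The number of levels, hence one more than the length of \<open>w\<close>.\<close>

abbreviation rank :: nat where "rank \<equiv> Suc (card (vinv n w))"

lemma card_inj_on_chain:
  assumes "C \<subseteq> W" "\<And>x y. x \<in> C \<Longrightarrow> y \<in> C \<Longrightarrow> weak_le n x y \<or> weak_le n y x"
  shows "inj_on (\<lambda>u. card (vinv n u)) C" "(\<lambda>u. card (vinv n u)) ` C \<subseteq> {..card (vinv n w)}"
proof -
  show "inj_on (\<lambda>u. card (vinv n u)) C"
  proof (rule inj_onI, rule ccontr)
    fix x y assume "x \<in> C" "y \<in> C" "card (vinv n x) = card (vinv n y)" "x \<noteq> y"
    moreover from this have "x \<in> W" "y \<in> W" using assms(1) by blast+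
    ultimately show False
      using assms(2)[of x y] weak_le_less_card[of x y] weak_le_less_card[of y x] by auto
  qed
  have "card (vinv n u) \<le> card (vinv n w)" if "u \<in> C" for u
    using that assms(1) W_iff[of u] by (intro card_mono finite_Inversions) blast
  then show "(\<lambda>u. card (vinv n u)) ` C \<subseteq> {..card (vinv n w)}" by auto
qed

lemma maxchain_chain:
  assumes "pred_on.maxchain W (weak_le n) C"
  shows "C \<subseteq> W" "x \<in> C \<Longrightarrow> y \<in> C \<Longrightarrow> weak_le n x y \<or> weak_le n y x"
proof -
  have chain: "pred_on.chain W (weak_le n) C"
    using assms by (simp add: pred_on.maxchain_def)
  then show "C \<subseteq> W" by (simp add: pred_on.chain_def)
  show "weak_le n x y \<or> weak_le n y x" if "x \<in> C" "y \<in> C"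
  proof -
    have "weak_le n x y \<or> x = y \<or> weak_le n y x"
      using chain that unfolding pred_on.chain_def by blast
    then show ?thesis by (auto simp: weak_le_def)
  qed
qed

lemma chain_le_of_card_le:
  assumes "C \<subseteq> W" "\<And>x y. x \<in> C \<Longrightarrow> y \<in> C \<Longrightarrow> weak_le n x y \<or> weak_le n y x"
    and "x \<in> C" "y \<in> C" "card (vinv n x) \<le> card (vinv n y)"
  shows "weak_le n x y"
  using assms(2)[OF assms(3,4)] weak_le_less_card[of y x] assms(1,3-5)
  by (cases "x = y") (auto simp: weak_le_def)

text \<open>If a level is skipped, \<open>ex_between\<close> gives an element one level above the
  last chain element before the gap and still below the next one. It is comparable with the whole
  chain, so maximality puts it into the chain and into the gap.\<close>

lemma maxchain_levels:
  assumes "pred_on.maxchain W (weak_le n) C"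
  shows "(\<lambda>u. card (vinv n u)) ` C = {..card (vinv n w)}"
proof -
  let ?l = "\<lambda>u. card (vinv n u)"
  note CW = maxchain_chain(1)[OF assms] and cmp = maxchain_chain(2)[OF assms]
  have max: "r \<in> C" if "r \<in> W" "\<And>x. x \<in> C \<Longrightarrow> weak_le n x r \<or> weak_le n r x" for r
  proof (rule ccontr)
    assume "r \<notin> C"
    moreover have "pred_on.chain W (weak_le n) (insert r C)"
      using that CW cmp unfolding pred_on.chain_def by blast
    ultimately show False using assms unfolding pred_on.maxchain_def by blast
  qed
  have id: "id \<in> C" by (rule max) (auto simp: id_in_W weak_le_def Inversions_def)
  have w: "w \<in> C"
  proof (rule max)
    show "weak_le n x w \<or> weak_le n w x" if "x \<in> C" for x
      using that CW W_iff[of x] by (auto simp: weak_le_def)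
  qed (rule w_in_W)
  have finC: "finite C" using CW finite_W by (rule finite_subset)
  have "m \<in> ?l ` C" if m: "m \<le> ?l w" for m
  proof (rule ccontr)
    assume "m \<notin> ?l ` C"
    let ?L = "{c \<in> C. ?l c < m}" and ?U = "{c \<in> C. m < ?l c}"
    have "vinv n id = {}" by (auto simp: Inversions_def)
    then have id0: "?l id = 0" by simp
    have "m \<noteq> ?l x" if "x \<in> C" for x using \<open>m \<notin> ?l ` C\<close> that by blast
    note ne = this
    have "id \<in> ?L" using id id0 ne[of id] by simp
    moreover have "finite ?L" using finC by simp
    ultimately obtain c where c: "c \<in> ?L" "\<And>x. x \<in> ?L \<Longrightarrow> ?l x \<le> ?l c"
      using ex_max_image[of ?L _ ?l] by blast
    have "w \<in> ?U" using w m ne[of w] by simp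
    moreover have "finite ?U" using finC by simp
    ultimately obtain d where d: "d \<in> ?U" "\<And>x. x \<in> ?U \<Longrightarrow> ?l d \<le> ?l x"
      using ex_min_image[of ?U _ ?l] by blast
    have lt: "?l c < ?l d" using c d by auto
    note le_iff = chain_le_of_card_le[OF CW cmp]
    have cW: "c \<in> W" and dW: "d \<in> W" using c(1) d(1) CW by blast+
    have cd_ne: "c \<noteq> d" using lt by blast
    have cd: "weak_le n c d" using le_iff lt c d by auto
    obtain k where k: "c \<circ> adj k \<in> W" "weak_le n c (c \<circ> adj k)" "weak_le n (c \<circ> adj k) d"
        "?l (c \<circ> adj k) = Suc (?l c)"
      using ex_between[OF cW dW cd cd_ne] by blast
    have trichotomy: "?l x \<le> ?l c \<or> ?l d \<le> ?l x" if "x \<in> C" for x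
      using that c(2)[of x] d(2)[of x] ne[of x] by (cases "?l x < m"; cases "m < ?l x") auto
    have "c \<circ> adj k \<in> C"
    proof (rule max)
      show "weak_le n x (c \<circ> adj k) \<or> weak_le n (c \<circ> adj k) x" if "x \<in> C" for x
      proof (cases "?l x \<le> ?l c")
        case True
        then have "weak_le n x c" using le_iff that c by auto
        then show ?thesis using k(2) by (auto simp: weak_le_def)
      next
        case False
        then have "weak_le n d x" using le_iff trichotomy that d by auto
        then show ?thesis using k(3) by (auto simp: weak_le_def)
      qed
    qed (fact k)
    then have "?l d \<le> Suc (?l c)" using trichotomy[of "c \<circ> adj k"] k(4) by simp
    then show False using c d by auto
  qed
  then show ?thesis using card_inj_on_chain(2)[OF CW cmp] by auto
qed

lemma maxchain_iff: "pred_on.maxchain W (weak_le n) C \<longleftrightarrow> C \<in> graded_maxchains W (weak_le n) rank"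
proof
  assume C: "pred_on.maxchain W (weak_le n) C"
  note CW = maxchain_chain(1)[OF C] and cmp = maxchain_chain(2)[OF C]
  have "card C = card ((\<lambda>u. card (vinv n u)) ` C)"
    using card_inj_on_chain(1)[OF CW cmp] by (simp add: card_image)
  then show "C \<in> graded_maxchains W (weak_le n) rank"
    using CW cmp unfolding maxchain_levels[OF C] graded_maxchains_def by auto
next
  assume C: "C \<in> graded_maxchains W (weak_le n) rank"
  then have CW: "C \<subseteq> W" and cmp: "\<And>x y. x \<in> C \<Longrightarrow> y \<in> C \<Longrightarrow> weak_le n x y \<or> weak_le n y x" and card: "card C = rank"
    by (auto simp: graded_maxchains_def)
  have "C = D" if D: "D \<subseteq> W" "C \<subseteq> D" "\<And>x y. x \<in> D \<Longrightarrow> y \<in> D \<Longrightarrow> weak_le n x y \<or> weak_le n y x" for D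
  proof -
    have "card D \<le> rank"
      using card_inj_on_le[OF card_inj_on_chain[OF D(1,3)]] by simp
    then show ?thesis using D(1,2) finite_W card by (intro card_seteq) (auto dest: finite_subset)
  qed
  note max = this
  show "pred_on.maxchain W (weak_le n) C"
    unfolding pred_on.maxchain_def
  proof (intro conjI notI)
    show "pred_on.chain W (weak_le n) C"
      unfolding pred_on.chain_def
    proof (intro conjI ballI)
      show "(weak_le n)\<^sup>=\<^sup>= x y \<or> (weak_le n)\<^sup>=\<^sup>= y x" if "x \<in> C" "y \<in> C" for x y
        using cmp[OF that] by auto
    qed (fact CW)
    assume "\<exists>S. pred_on.chain W (weak_le n) S \<and> C \<subset> S"
    then obtain S where S: "pred_on.chain W (weak_le n) S" "C \<subset> S" by blast
    have "weak_le n x y \<or> weak_le n y x" if "x \<in> S" "y \<in> S" for x y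
    proof -
      have "weak_le n x y \<or> x = y \<or> weak_le n y x"
        using S(1) that unfolding pred_on.chain_def by blast
      then show ?thesis by (auto simp: weak_le_def)
    qed
    moreover have "S \<subseteq> W" using S(1) unfolding pred_on.chain_def by blast
    ultimately show False using max[of S] S(2) by blast
  qed
qed

end

section \<open>Toggle symmetry in the weak order\<close>

lemma transpose_comp_eq:
  assumes "inj u"
  shows "Transposition.transpose (u k) (u l) \<circ> u = u \<circ> Transposition.transpose k l"
  using assms by (auto simp: fun_eq_iff Transposition.transpose_def inj_eq)

text \<open>For words in which \<open>i\<close> and \<open>j\<close> need not be neighbours, this replaces the third component of the
  edge label. It persists along a chain as long as the pair is not crossed, which is why the
  chain crosses the pair at an edge with the same label.\<close>

definition sides :: "nat \<Rightarrow> nat \<Rightarrow> nat set \<Rightarrow> (nat \<Rightarrow> nat) \<Rightarrow> bool" where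
  "sides i j Z c \<longleftrightarrow> (\<forall>x. i < x \<and> x < j \<longrightarrow>
     (if x \<in> Z then inv c x < inv c i \<and> inv c x < inv c j else inv c i < inv c x \<and> inv c j < inv c x))"

lemma inv_transpose_comp:
  assumes "c permutes S"
  shows "inv (Transposition.transpose i j \<circ> c) x = inv c (Transposition.transpose i j x)"
proof -
  have "inv (Transposition.transpose i j \<circ> c) = inv c \<circ> inv (Transposition.transpose i j)"
    by (rule o_inv_distrib) (auto intro: permutes_bij[OF assms])
  then show ?thesis by simp
qed

lemma sides_transpose:
  assumes "c permutes S" "sides i j Z c"
  shows "sides i j Z (Transposition.transpose i j \<circ> c)"
  unfolding sides_def inv_transpose_comp[OF assms(1)]
proof (intro allI impI)
  fix x assume x: "i < x \<and> x < j"
  then have "Transposition.transpose i j x = x" by (intro transpose_apply_other) auto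
  then show "if x \<in> Z
         then inv c (Transposition.transpose i j x) < inv c (Transposition.transpose i j i) \<and>
              inv c (Transposition.transpose i j x) < inv c (Transposition.transpose i j j)
         else inv c (Transposition.transpose i j i) < inv c (Transposition.transpose i j x) \<and>
              inv c (Transposition.transpose i j j) < inv c (Transposition.transpose i j x)"
    using assms(2) x unfolding sides_def by (auto split: if_splits)
qed

text \<open>Inversions persist upwards. The inversion \<open>(i, x)\<close> for
  \<open>x \<in> Z\<close>, or \<open>(x, j)\<close> otherwise, fixes the side of \<open>x\<close>
  relative to one of the two letters; the other one follows since \<open>i\<close> still precedes
  \<open>j\<close>.\<close>

lemma sides_up:
  assumes c: "c permutes {1..n}" and ij: "1 \<le> i" "j \<le> n"
    and s: "sides i j Z u" and le: "vinv n u \<subseteq> vinv n c" and low: "(i, j) \<notin> vinv n c"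
  shows "sides i j Z c"
  unfolding sides_def
proof (intro allI impI)
  fix x assume x: "i < x \<and> x < j"
  have lt: "inv c i < inv c j"
    using low ij x permutes_inv_eq_iff[OF c, of i j] by (auto simp: vinv_iff)
  show "if x \<in> Z then inv c x < inv c i \<and> inv c x < inv c j else inv c i < inv c x \<and> inv c j < inv c x"
  proof (cases "x \<in> Z")
    case True
    then have "(i, x) \<in> vinv n u" using s x ij by (auto simp: sides_def vinv_iff)
    then have "(i, x) \<in> vinv n c" using le by blast
    then show ?thesis using True lt by (simp add: vinv_iff)
  next
    case False
    then have "(x, j) \<in> vinv n u" using s x ij by (auto simp: sides_def vinv_iff)
    then have "(x, j) \<in> vinv n c" using le by blast
    then show ?thesis using False lt by (simp add: vinv_iff)
  qed
qed

text \<open>The mirror image: non-inversions persist downwards, and \<open>j\<close> still precedes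
  \<open>i\<close>.\<close>

lemma sides_down:
  assumes c: "c permutes {1..n}" and s: "sides i j Z u" and le: "vinv n c \<subseteq> vinv n u"
    and high: "(i, j) \<in> vinv n c"
  shows "sides i j Z c"
  unfolding sides_def
proof (intro allI impI)
  fix x assume x: "i < x \<and> x < j"
  have ij: "1 \<le> i" "j \<le> n" "inv c j < inv c i" using high by (auto simp: vinv_iff)
  show "if x \<in> Z then inv c x < inv c i \<and> inv c x < inv c j else inv c i < inv c x \<and> inv c j < inv c x"
  proof (cases "x \<in> Z")
    case True
    then have "(x, j) \<notin> vinv n u" using s x by (auto simp: sides_def vinv_iff)
    then have "(x, j) \<notin> vinv n c" using le by blast
    then have "inv c x < inv c j"
      using x ij permutes_inv_eq_iff[OF c, of x j] by (auto simp: vinv_iff)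
    then show ?thesis using True ij by simp
  next
    case False
    then have "(i, x) \<notin> vinv n u" using s x by (auto simp: sides_def vinv_iff)
    then have "(i, x) \<notin> vinv n c" using le by blast
    then have "inv c i < inv c x"
      using x ij permutes_inv_eq_iff[OF c, of i x] by (auto simp: vinv_iff)
    then show ?thesis using False ij by simp
  qed
qed

text \<open>The exchange reverses the order of values only for \<open>(i, j)\<close> and for pairs
  of \<open>i\<close> or \<open>j\<close> with an intermediate letter. The former is in the same
  state in \<open>c\<close> and \<open>d\<close> by assumption, the latter are determined by
  \<open>Z\<close>; all other pairs carry their inversions along.\<close>

lemma vinv_transpose_mono:
  assumes c: "c permutes {1..n}" and d: "d permutes {1..n}" and ij: "1 \<le> i" "i < j" "j \<le> n"
    and sc: "sides i j Z c" and sd: "sides i j Z d"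
    and le: "vinv n c \<subseteq> vinv n d" and same: "(i, j) \<in> vinv n c \<longleftrightarrow> (i, j) \<in> vinv n d"
  shows "vinv n (Transposition.transpose i j \<circ> c) \<subseteq> vinv n (Transposition.transpose i j \<circ> d)"
proof (rule subsetI, unfold split_paired_all)
  fix p q assume pq: "(p, q) \<in> vinv n (Transposition.transpose i j \<circ> c)"
  define t where "t = Transposition.transpose i j"
  have r: "1 \<le> p" "p < q" "q \<le> n" and lt: "inv c (t q) < inv c (t p)"
    using pq by (auto simp: vinv_iff inv_transpose_comp[OF c] t_def)
  have "inv d (t q) < inv d (t p)"
  proof (cases "t p < t q")
    case True
    have "1 \<le> t p" "t q \<le> n" using r ij by (auto simp: t_def Transposition.transpose_def)
    then have "(t p, t q) \<in> vinv n c" using True lt by (simp add: vinv_iff)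
    then have "(t p, t q) \<in> vinv n d" using le by blast
    then show ?thesis by (simp add: vinv_iff)
  next
    case False
    then consider "p = i" "q = j" | "p = i" "i < q" "q < j" | "q = j" "i < p" "p < j"
      using r ij by (auto simp: t_def Transposition.transpose_def split: if_splits)
    then show ?thesis
    proof cases
      case 1
      then have "(i, j) \<notin> vinv n c" using lt by (simp add: vinv_iff t_def)
      then have "inv d i < inv d j"
        using same ij permutes_inv_eq_iff[OF d, of i j] by (auto simp: vinv_iff)
      then show ?thesis using 1 by (simp add: t_def)
    next
      case 2
      then have t: "t q = q" "t p = j" by (auto simp: t_def intro: transpose_apply_other)
      then have "q \<in> Z" using lt sc 2 by (auto simp: sides_def split: if_splits)
      then show ?thesis using sd 2 t by (auto simp: sides_def)
    next
      case 3
      then have t: "t p = p" "t q = i" by (auto simp: t_def intro: transpose_apply_other)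
      then have "p \<notin> Z" using lt sc 3 by (auto simp: sides_def split: if_splits)
      then show ?thesis using sd 3 t by (auto simp: sides_def)
    qed
  qed
  then show "(p, q) \<in> vinv n (Transposition.transpose i j \<circ> d)"
    using r by (simp add: vinv_iff inv_transpose_comp[OF d] t_def)
qed

text \<open>No letter fits between neighbours, so standing left of one of them is standing left of
  both.\<close>

lemma edge_label_eq_iff:
  assumes u: "u permutes S" and Z: "Z \<subseteq> {i<..<j}" and ij: "i < j"
    and k: "u k = i \<and> u (Suc k) = j \<or> u k = j \<and> u (Suc k) = i"
  shows "edge_label u k = (i, j, Z) \<longleftrightarrow> sides i j Z u"
proof -
  have lab: "edge_label u k = (i, j, {z. i < z \<and> z < j \<and> inv u z < k})"
    using k ij by (auto simp: edge_label_def Let_def)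
  have pos: "{inv u i, inv u j} = {k, Suc k}"
    using k permutes_inv_apply(1)[OF u, of k] permutes_inv_apply(1)[OF u, of "Suc k"] by (elim disjE conjE) auto
  have ne: "inv u x \<noteq> k \<and> inv u x \<noteq> Suc k" if "i < x" "x < j" for x
    using that k permutes_inv_apply(2)[OF u, of x] by auto
  have "sides i j Z u \<longleftrightarrow> (\<forall>x. i < x \<and> x < j \<longrightarrow> (x \<in> Z \<longleftrightarrow> inv u x < k))"
  proof -
    have "(if x \<in> Z then inv u x < inv u i \<and> inv u x < inv u j else inv u i < inv u x \<and> inv u j < inv u x)
        \<longleftrightarrow> (x \<in> Z \<longleftrightarrow> inv u x < k)" if "i < x" "x < j" for x
      using ne[OF that] pos by (auto simp: doubleton_eq_iff)
    then show ?thesis unfolding sides_def by blast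
  qed
  also have "\<dots> \<longleftrightarrow> Z = {z. i < z \<and> z < j \<and> inv u z < k}"
    using Z by auto
  finally show ?thesis unfolding lab by auto
qed

lemma edge_label_subset:
  assumes "edge_label u k = (i, j, Z)"
  shows "Z \<subseteq> {i<..<j}"
  using assms by (auto simp: edge_label_def Let_def)

section \<open>Edges with a fixed label\<close>

context inversion_diagram
begin

definition up_edges :: "nat \<times> nat \<times> nat set \<Rightarrow> (nat \<Rightarrow> nat) set" where
  "up_edges L = {u \<in> W. \<exists>k. 1 \<le> k \<and> k < n \<and> u k < u (Suc k) \<and> (u k, u (Suc k)) \<in> vinv n w \<and> edge_label u k = L}"

definition down_edges :: "nat \<times> nat \<times> nat set \<Rightarrow> (nat \<Rightarrow> nat) set" where
  "down_edges L = {u \<in> W. \<exists>k. 1 \<le> k \<and> k < n \<and> u (Suc k) < u k \<and> edge_label u k = L}"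

lemma up_edgesE:
  assumes "u \<in> up_edges (i, j, Z)"
  obtains k where "1 \<le> k" "k < n" "u k = i" "u (Suc k) = j" "i < j" "(i, j) \<in> vinv n w" "Z \<subseteq> {i<..<j}"
    "sides i j Z u" "u \<in> W" "u permutes {1..n}" "(i, j) \<notin> vinv n u" "Transposition.transpose i j \<circ> u = u \<circ> adj k"
proof -
  obtain k where k: "u \<in> W" "1 \<le> k" "k < n" "u k < u (Suc k)" "(u k, u (Suc k)) \<in> vinv n w"
      "edge_label u k = (i, j, Z)"
    using assms by (auto simp: up_edges_def)
  have u: "u permutes {1..n}" using k by (simp add: W_iff)
  have ij: "u k = i" "u (Suc k) = j" using k by (auto simp: edge_label_def Let_def)
  have "sides i j Z u"
    using edge_label_eq_iff[OF u edge_label_subset[OF k(6)], of k] ij k by auto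
  then show ?thesis
    using that[of k] k ij u edge_label_subset[OF k(6)] vinv_ascent(2)[OF u k(2-4)]
      transpose_comp_eq[OF permutes_inj[OF u], of k "Suc k"] by simp
qed

lemma down_edgesE:
  assumes "u \<in> down_edges (i, j, Z)"
  obtains k where "1 \<le> k" "k < n" "u k = j" "u (Suc k) = i" "i < j" "(i, j) \<in> vinv n w" "Z \<subseteq> {i<..<j}"
    "sides i j Z u" "u \<in> W" "u permutes {1..n}" "(i, j) \<in> vinv n u" "Transposition.transpose i j \<circ> u = u \<circ> adj k"
proof -
  obtain k where k: "u \<in> W" "1 \<le> k" "k < n" "u (Suc k) < u k" "edge_label u k = (i, j, Z)"
    using assms by (auto simp: down_edges_def)
  have u: "u permutes {1..n}" "vinv n u \<subseteq> vinv n w" using k by (simp_all add: W_iff)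
  have ij: "u (Suc k) = i" "u k = j" using k by (auto simp: edge_label_def Let_def)
  have "sides i j Z u"
    using edge_label_eq_iff[OF u(1) edge_label_subset[OF k(5)], of k] ij k by auto
  moreover have "(i, j) \<in> vinv n u"
    using vinv_descent(1)[OF u(1) k(2-4)] ij by simp
  ultimately show ?thesis
    using that[of k] k ij u edge_label_subset[OF k(5)]
      transpose_comp_eq[OF permutes_inj[OF u(1)], of k "Suc k"]
    by (auto simp: transpose_commute)
qed

lemma up_edgesI:
  assumes "u \<in> W" "1 \<le> k" "k < n" "u k = i" "u (Suc k) = j" "i < j" "(i, j) \<in> vinv n w" "Z \<subseteq> {i<..<j}" "sides i j Z u"
  shows "u \<in> up_edges (i, j, Z)"
  using assms edge_label_eq_iff[of u "{1..n}" Z i j k] unfolding up_edges_def by (auto simp: W_iff)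

lemma down_edgesI:
  assumes "u \<in> W" "1 \<le> k" "k < n" "u k = j" "u (Suc k) = i" "i < j" "Z \<subseteq> {i<..<j}" "sides i j Z u"
  shows "u \<in> down_edges (i, j, Z)"
  using assms edge_label_eq_iff[of u "{1..n}" Z i j k] unfolding down_edges_def by (auto simp: W_iff)

lemma transpose_up_edges:
  assumes "u \<in> up_edges (i, j, Z)"
  shows "Transposition.transpose i j \<circ> u \<in> down_edges (i, j, Z)" "weak_le n u (Transposition.transpose i j \<circ> u)"
proof -
  from assms obtain k where k: "1 \<le> k" "k < n" "u k = i" "u (Suc k) = j" "i < j" "(i, j) \<in> vinv n w" "Z \<subseteq> {i<..<j}"
    "sides i j Z u" "u \<in> W" "u permutes {1..n}" "(i, j) \<notin> vinv n u" "Transposition.transpose i j \<circ> u = u \<circ> adj k"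
    by (rule up_edgesE)
  have "u \<circ> adj k \<in> W" using W_ascent[of u k] k by auto
  then show "Transposition.transpose i j \<circ> u \<in> down_edges (i, j, Z)"
    using sides_transpose[OF k(10,8)] k unfolding k(12)
    by (intro down_edgesI[of _ k]) auto
  show "weak_le n u (Transposition.transpose i j \<circ> u)"
    using vinv_ascent(1)[OF k(10,1,2)] k unfolding k(12) weak_le_def by auto
qed

lemma transpose_down_edges:
  assumes "u \<in> down_edges (i, j, Z)"
  shows "Transposition.transpose i j \<circ> u \<in> up_edges (i, j, Z)"
proof -
  from assms obtain k where k: "1 \<le> k" "k < n" "u k = j" "u (Suc k) = i" "i < j" "(i, j) \<in> vinv n w" "Z \<subseteq> {i<..<j}"
    "sides i j Z u" "u \<in> W" "u permutes {1..n}" "(i, j) \<in> vinv n u" "Transposition.transpose i j \<circ> u = u \<circ> adj k"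
    by (rule down_edgesE)
  have "u \<circ> adj k \<in> W" using W_descent[of u k] k by auto
  then show ?thesis
    using sides_transpose[OF k(10,8)] k unfolding k(12)
    by (intro up_edgesI[of _ k]) auto
qed

text \<open>Since no level is skipped, the last chain element \<open>v\<close> without the inversion
  \<open>(i, j)\<close> and the first one with it lie on consecutive levels. They differ in this one
  inversion, which makes \<open>i\<close> and \<open>j\<close> neighbours in
  \<open>v\<close>.\<close>

lemma maxchain_crossing:
  assumes C: "C \<in> graded_maxchains W (weak_le n) rank"
    and meets: "C \<inter> (up_edges (i, j, Z) \<union> down_edges (i, j, Z)) \<noteq> {}"
  defines "t \<equiv> \<lambda>c. Transposition.transpose i j \<circ> c"
  shows "\<exists>v\<in>up_edges (i, j, Z). v \<in> C \<and> t v \<in> C \<and>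
    (\<forall>c\<in>C. (i, j) \<notin> vinv n c \<longrightarrow> weak_le n c v) \<and> (\<forall>c\<in>C. \<not> (i, j) \<notin> vinv n c \<longrightarrow> weak_le n (t v) c)"
proof -
  let ?l = "\<lambda>u. card (vinv n u)"
  have mc: "pred_on.maxchain W (weak_le n) C" using C maxchain_iff by blast
  note CW = maxchain_chain(1)[OF mc] and cmp = maxchain_chain(2)[OF mc]
  note levels = maxchain_levels[OF mc]
  note le_iff = chain_le_of_card_le[OF CW cmp]
  have finC: "finite C" using CW finite_W by (rule finite_subset)
  have ij: "i < j" "(i, j) \<in> vinv n w" "Z \<subseteq> {i<..<j}"
    using meets by (auto elim: up_edgesE down_edgesE)
  let ?L = "{c \<in> C. (i, j) \<notin> vinv n c}" and ?U = "{c \<in> C. (i, j) \<in> vinv n c}"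
  obtain c0 where c0: "c0 \<in> C" "?l c0 = 0" using levels by (auto simp: set_eq_iff image_iff) (metis zero_le)
  then have "c0 \<in> ?L" using finite_Inversions by auto
  moreover have "finite ?L" using finC by simp
  ultimately obtain v where v: "v \<in> ?L" "\<And>x. x \<in> ?L \<Longrightarrow> ?l x \<le> ?l v"
    using ex_max_image[of ?L c0 ?l] by blast
  have "?l w \<in> ?l ` C" unfolding levels by simp
  then obtain c1 where c1: "c1 \<in> C" "?l c1 = ?l w" by auto
  have "vinv n c1 = vinv n w"
    using c1 CW W_iff[of c1] by (intro card_subset_eq finite_Inversions) auto
  then have "c1 \<in> ?U" using c1 ij by simp
  moreover have "finite ?U" using finC by simp
  ultimately obtain v' where v': "v' \<in> ?U" "\<And>x. x \<in> ?U \<Longrightarrow> ?l v' \<le> ?l x"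
    using ex_min_image[of ?U c1 ?l] by blast
  have vle: "weak_le n v v'"
    using cmp[of v v'] v v' unfolding weak_le_def by blast
  have ne: "v \<noteq> v'" using v v' by auto
  have W: "v \<in> W" "v' \<in> W" using v v' CW by auto
  have lt: "?l v < ?l v'" using weak_le_less_card[OF W vle ne] .
  have "?l v' \<le> ?l w" using levels v' by blast
  then have "Suc (?l v) \<in> ?l ` C" unfolding levels using lt by simp
  then obtain x where x: "x \<in> C" "?l x = Suc (?l v)" by auto
  then have "x \<in> ?U" using v(2)[of x] by auto
  then have l': "?l v' = Suc (?l v)" using v'(2)[of x] x lt by simp
  obtain k where k: "1 \<le> k" "k < n" "v k < v (Suc k)" "v \<circ> adj k \<in> W" "weak_le n (v \<circ> adj k) v'"
      "?l (v \<circ> adj k) = Suc (?l v)"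
    using ex_between[OF W vle ne] by blast
  have vp: "v permutes {1..n}" "v' permutes {1..n}" using W by (auto simp: W_iff)
  have eq: "vinv n (v \<circ> adj k) = vinv n v'"
    using k l' unfolding weak_le_def by (intro card_subset_eq finite_Inversions) auto
  then have v'_eq: "v' = v \<circ> adj k"
    using vinv_inj[of "v \<circ> adj k" n v'] k(4) vp W_iff by blast
  have "(i, j) \<in> insert (v k, v (Suc k)) (vinv n v)"
    using v'(1) eq vinv_ascent(1)[OF vp(1) k(1-3)] by simp
  then have vk: "v k = i" "v (Suc k) = j" using v by auto
  have tv: "t v = v'"
    unfolding t_def v'_eq using transpose_comp_eq[OF permutes_inj[OF vp(1)], of k "Suc k"] vk by simp
  have tt: "t (t c) = c" for c
    by (simp add: t_def o_assoc)
  have bounds: "1 \<le> i" "j \<le> n" using ij by (auto simp: vinv_iff)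
  \<comment> \<open>From an element with an upward edge the condition is carried up to
    \<open>v\<close>; from one with a downward edge it is carried down to \<open>t v\<close> and
    then exchanged back.\<close>
  have "sides i j Z v"
  proof -
    consider u where "u \<in> C" "u \<in> up_edges (i, j, Z)" | u where "u \<in> C" "u \<in> down_edges (i, j, Z)"
      using meets by blast
    then show ?thesis
    proof cases
      case 1
      from 1(2) have u: "sides i j Z u" "(i, j) \<notin> vinv n u" by (auto elim: up_edgesE)
      then have "weak_le n u v" using le_iff[of u v] v 1 by auto
      then show ?thesis
        using sides_up[OF vp(1) bounds u(1)] v by (auto simp: weak_le_def)
    next
      case 2
      from 2(2) have u: "sides i j Z u" "(i, j) \<in> vinv n u" by (auto elim: down_edgesE)
      then have "weak_le n v' u" using le_iff[of v' u] v' 2 by auto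
      then have "sides i j Z v'"
        using sides_down[OF vp(2) u(1)] v' by (auto simp: weak_le_def)
      then have "sides i j Z (t v')"
        unfolding t_def by (rule sides_transpose[OF vp(2)])
      then show ?thesis unfolding tv[symmetric] tt .
    qed
  qed
  then have "v \<in> up_edges (i, j, Z)"
    using up_edgesI[OF W(1) k(1,2) vk] ij by auto
  moreover have "weak_le n c v" if "c \<in> C" "(i, j) \<notin> vinv n c" for c
    using le_iff[of c v] v that by auto
  moreover have "weak_le n v' c" if "c \<in> C" "(i, j) \<in> vinv n c" for c
    using le_iff[of v' c] v' that by auto
  ultimately show ?thesis using v v' tv by (intro bexI[of _ v]) auto
qed

lemma toggle_weak_order:
  "toggle W (weak_le n) rank (\<lambda>c. (i, j) \<notin> vinv n c) (\<lambda>c. Transposition.transpose i j \<circ> c)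
     (up_edges (i, j, Z)) (down_edges (i, j, Z))"
proof (rule toggle.intro)
  let ?t = "\<lambda>c. Transposition.transpose i j \<circ> c"
  let ?A = "up_edges (i, j, Z)" and ?B = "down_edges (i, j, Z)"
  have perm: "c permutes {1..n}" if "c \<in> W" for c using that by (simp add: W_iff)
  have A: "i < j" "1 \<le> i" "j \<le> n" "sides i j Z u" "u \<in> W" "(i, j) \<notin> vinv n u" if "u \<in> ?A" for u
    using that by (auto elim!: up_edgesE simp: vinv_iff)
  have B: "i < j" "1 \<le> i" "j \<le> n" "sides i j Z u" "u \<in> W" "(i, j) \<in> vinv n u" if "u \<in> ?B" for u
    using that by (auto elim!: down_edgesE simp: vinv_iff)
  have tperm: "?t c permutes {1..n}" if "c \<in> W" "1 \<le> i" "i < j" "j \<le> n" for c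
    using that perm by (intro permutes_compose[OF perm] permutes_swap_id) auto
  have low_down: "(i, j) \<notin> vinv n x" if "weak_le n x y" "(i, j) \<notin> vinv n y" for x y
    using that by (auto simp: weak_le_def)
  have sA: "sides i j Z c" "(i, j) \<notin> vinv n c"
    if "u \<in> ?A" "v \<in> ?A" "c \<in> W" "weak_le n u c" "weak_le n c v" for u v c
  proof -
    show "(i, j) \<notin> vinv n c" using low_down that A(6) by blast
    then show "sides i j Z c"
      using sides_up[OF perm[OF that(3)] A(2,3)[OF that(1)] A(4)[OF that(1)]] that(4) by (auto simp: weak_le_def)
  qed
  have sB: "sides i j Z c" "(i, j) \<in> vinv n c"
    if "u \<in> ?B" "v \<in> ?B" "c \<in> W" "weak_le n u c" "weak_le n c v" for u v c
  proof -
    show "(i, j) \<in> vinv n c" using low_down that B(6) by blast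
    then show "sides i j Z c"
      using sides_down[OF perm[OF that(3)] B(4)[OF that(2)]] that(5) by (auto simp: weak_le_def)
  qed
  have refl: "weak_le n x x" for x by (simp add: weak_le_def)
  show mono_A: "weak_le n (?t c) (?t d)"
    if "u \<in> ?A" "v \<in> ?A" "c \<in> W" "d \<in> W" "weak_le n u c" "weak_le n c d" "weak_le n d v" for u v c d
  proof -
    have "weak_le n c v" "weak_le n u d" using that by (auto simp: weak_le_def)
    then show ?thesis
      using vinv_transpose_mono[OF perm[OF that(3)] perm[OF that(4)] A(2)[OF that(1)] A(1)[OF that(1)] A(3)[OF that(1)]]
        sA[of u v c] sA[of u v d] that by (auto simp: weak_le_def)
  qed
  show mono_B: "weak_le n (?t c) (?t d)"
    if "u \<in> ?B" "v \<in> ?B" "c \<in> W" "d \<in> W" "weak_le n u c" "weak_le n c d" "weak_le n d v" for u v c d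
  proof -
    have "weak_le n c v" "weak_le n u d" using that by (auto simp: weak_le_def)
    then show ?thesis
      using vinv_transpose_mono[OF perm[OF that(3)] perm[OF that(4)] B(2)[OF that(1)] B(1)[OF that(1)] B(3)[OF that(1)]]
        sB[of u v c] sB[of u v d] that by (auto simp: weak_le_def)
  qed
  show "?t c \<in> W \<and> \<not> (i, j) \<notin> vinv n (?t c)"
    if "u \<in> ?A" "v \<in> ?A" "c \<in> W" "weak_le n u c" "weak_le n c v" for u v c
  proof
    note ij = A(1-3)[OF that(1)]
    \<comment> \<open>The interval is a down-set, so lying below the element \<open>?t v\<close> of
      it suffices.\<close>
    have "weak_le n (?t c) (?t v)" using mono_A[OF that(1,2,3) A(5)[OF that(2)] that(4,5) refl] .
    moreover have "?t v \<in> W" using transpose_up_edges(1)[OF that(2)] B(5) by blast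
    ultimately show "?t c \<in> W" using W_down tperm[OF that(3) ij(2,1,3)] by blast
    have "inv c i < inv c j"
      using sA(2)[OF that] ij permutes_inv_eq_iff[OF perm[OF that(3)], of i j] by (auto simp: vinv_iff)
    then show "\<not> (i, j) \<notin> vinv n (?t c)"
      using ij by (simp add: vinv_iff inv_transpose_comp[OF perm[OF that(3)]])
  qed
  show "?t c \<in> W \<and> (i, j) \<notin> vinv n (?t c)"
    if "u \<in> ?B" "v \<in> ?B" "c \<in> W" "weak_le n u c" "weak_le n c v" for u v c
  proof
    note ij = B(1-3)[OF that(1)]
    have "weak_le n (?t c) (?t v)" using mono_B[OF that(1,2,3) B(5)[OF that(2)] that(4,5) refl] .
    moreover have "?t v \<in> W" using transpose_down_edges[OF that(2)] A(5) by blast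
    ultimately show "?t c \<in> W" using W_down tperm[OF that(3) ij(2,1,3)] by blast
    show "(i, j) \<notin> vinv n (?t c)"
      using sB(2)[OF that] by (simp add: vinv_iff inv_transpose_comp[OF perm[OF that(3)]])
  qed
  show "u \<in> W \<and> (i, j) \<notin> vinv n u \<and> ?t u \<in> ?B \<and> weak_le n u (?t u)" if "u \<in> ?A" for u
    using A(5,6)[OF that] transpose_up_edges[OF that] by blast
  show "u \<in> W \<and> \<not> (i, j) \<notin> vinv n u \<and> ?t u \<in> ?A" if "u \<in> ?B" for u
    using B(5,6)[OF that] transpose_down_edges[OF that] by blast
  show "?t (?t x) = x" for x by (simp add: o_assoc)
  show "weak_le n x z" if "weak_le n x y" "weak_le n y z" for x y z
    using that by (auto simp: weak_le_def)
qed (fact finite_W W_antisym maxchain_crossing | simp add: weak_le_def; blast)+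

text \<open>Toggle symmetry of the uniform distribution: an edge with this label has one lower and
  one upper end.\<close>

lemma card_up_edges: "card (up_edges L) = card (down_edges L)"
proof -
  obtain i j Z where L: "L = (i, j, Z)" by (cases L)
  have tt: "Transposition.transpose i j \<circ> (Transposition.transpose i j \<circ> c) = c" for c :: "nat \<Rightarrow> nat"
    by (simp add: o_assoc)
  show ?thesis
    unfolding L
    by (rule bij_betw_same_card[OF bij_betw_byWitness[where f = "\<lambda>c. Transposition.transpose i j \<circ> c"
            and f' = "\<lambda>c. Transposition.transpose i j \<circ> c"]])
      (use tt transpose_up_edges(1) transpose_down_edges in auto)
qed

text \<open>Toggle symmetry of the maximal chain distribution, obtained by counting chains with a
  marked element in two orders.\<close>

lemma sum_maxchains_up_edges:
  "(\<Sum>u\<in>up_edges L. card {C. pred_on.maxchain W (weak_le n) C \<and> u \<in> C}) =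
   (\<Sum>u\<in>down_edges L. card {C. pred_on.maxchain W (weak_le n) C \<and> u \<in> C})"
proof -
  obtain i j Z where L: "L = (i, j, Z)" by (cases L)
  have count: "(\<Sum>u\<in>U. card {C. pred_on.maxchain W (weak_le n) C \<and> u \<in> C}) =
      card {(C, u). C \<in> graded_maxchains W (weak_le n) rank \<and> u \<in> C \<inter> U}" if "U \<subseteq> W" for U
  proof -
    have "finite U" using that finite_W by (rule finite_subset)
    moreover have "finite {C. pred_on.maxchain W (weak_le n) C \<and> u \<in> C}" for u
      by (rule finite_subset[OF _ finite_maxchains[OF finite_W]]) auto
    ultimately have "(\<Sum>u\<in>U. card {C. pred_on.maxchain W (weak_le n) C \<and> u \<in> C}) =
        card (SIGMA u:U. {C. pred_on.maxchain W (weak_le n) C \<and> u \<in> C})"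
      by (simp add: card_SigmaI)
    also have "\<dots> = card (prod.swap ` (SIGMA u:U. {C. pred_on.maxchain W (weak_le n) C \<and> u \<in> C}))"
      by (rule card_image[symmetric]) (auto simp: inj_on_def)
    also have "prod.swap ` (SIGMA u:U. {C. pred_on.maxchain W (weak_le n) C \<and> u \<in> C}) =
        {(C, u). C \<in> graded_maxchains W (weak_le n) rank \<and> u \<in> C \<inter> U}"
      unfolding maxchain_iff by auto
    finally show ?thesis .
  qed
  show ?thesis
    unfolding L using toggle.card_marked_chains_eq[OF toggle_weak_order[of i j Z]]
    by (subst (1 2) count) (auto simp: up_edges_def down_edges_def)
qed

end

section \<open>Down-degree expectations of toggle-symmetric weights\<close>

text \<open>Row balance involves only \<open>w\<close>; stated without a word, it can be passed on
  to every \<open>u\<close> of the interval.\<close>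

locale balanced_diagram = inversion_diagram +
  assumes row_balance: "\<And>x y. int (card cols) * int (card {t \<in> rows. lo t \<subseteq> lo x \<inter> lo y}) =
    int (card rows) * int (card (lo x \<inter> lo y))"
begin

lemma sum_gap_value:
  assumes "u \<in> W"
  shows "(\<Sum>k=1..<n. gap_value u k) = int (card rows) * int (card cols)"
\<comment> \<open>Without letters there is no first or last position at which the telescope could
  close.\<close>
proof (cases "n = 0")
  case True
  then have "rows = {}" using rows_subset by simp
  then show ?thesis using True by simp
next
  case False
  interpret balanced_inversion_word n w u
    by unfold_locales (use assms row_balance in \<open>auto simp: W_iff\<close>)
  show ?thesis using sum_gap_value False by simp
qed

lemma sum_gap_value_split:
  assumes "u \<in> W"
  shows "(\<Sum>k=1..<n. gap_value u k) =
    (\<Sum>k | 1 \<le> k \<and> k < n \<and> u (Suc k) < u k. static_value (edge_label u k)) +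
    (\<Sum>k | 1 \<le> k \<and> k < n \<and> u k < u (Suc k) \<and> (u k, u (Suc k)) \<in> vinv n w.
       int (card rows) + int (card cols) - static_value (edge_label u k))" (is "_ = sum ?d ?D + sum ?c ?A")
proof -
  interpret balanced_inversion_word n w u
    by unfold_locales (use assms row_balance in \<open>auto simp: W_iff\<close>)
  have ne: "u k \<noteq> u (Suc k)" for k
    using permutes_inj[OF u_permutes] by (simp add: inj_eq)
  let ?S = "{k. 1 \<le> k \<and> k < n \<and> u k < u (Suc k) \<and> (u k, u (Suc k)) \<notin> vinv n w}"
  have fin: "finite {k. 1 \<le> k \<and> k < n \<and> Q k}" for Q
    by (rule finite_subset[of _ "{..n}"]) auto
  have "{1..<n} = ?D \<union> (?A \<union> ?S)" using ne by (auto simp: neq_iff)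
  then have "(\<Sum>k=1..<n. gap_value u k) = sum (gap_value u) (?D \<union> (?A \<union> ?S))" by simp
  also have "\<dots> = sum (gap_value u) ?D + sum (gap_value u) (?A \<union> ?S)"
    by (rule sum.union_disjoint) (use fin in auto)
  also have "sum (gap_value u) (?A \<union> ?S) = sum (gap_value u) ?A + sum (gap_value u) ?S"
    by (rule sum.union_disjoint) (use fin in auto)
  also have "sum (gap_value u) ?S = 0"
    by (rule sum.neutral) (auto simp: lo_def intro!: gap_value_static)
  also have "sum (gap_value u) ?D = sum ?d ?D"
    by (rule sum.cong) (auto intro!: gap_value_descent)
  also have "sum (gap_value u) ?A = sum ?c ?A"
    by (rule sum.cong) (auto simp: lo_def intro!: gap_value_ascent)
  finally show ?thesis by simp
qed

definition up_steps :: "((nat \<Rightarrow> nat) \<times> nat) set" where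
  "up_steps = (SIGMA u:W. {k. 1 \<le> k \<and> k < n \<and> u k < u (Suc k) \<and> (u k, u (Suc k)) \<in> vinv n w})"

definition down_steps :: "((nat \<Rightarrow> nat) \<times> nat) set" where
  "down_steps = (SIGMA u:W. {k. 1 \<le> k \<and> k < n \<and> u (Suc k) < u k})"

lemma finite_steps: "finite up_steps" "finite down_steps"
proof -
  have "up_steps \<subseteq> W \<times> {..n}" "down_steps \<subseteq> W \<times> {..n}"
    by (auto simp: up_steps_def down_steps_def)
  then show "finite up_steps" "finite down_steps"
    using finite_W by (auto intro: finite_subset)
qed

text \<open>A label names both letters, so a word has at most one edge with that label. Sums over
  edges thus become sums over sets of words, the form in which toggle symmetry is available.\<close>

lemma sum_steps:
  fixes m :: "(nat \<Rightarrow> nat) \<Rightarrow> nat" and h :: "nat \<times> nat \<times> nat set \<Rightarrow> int"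
  assumes S: "finite S" "finite T" "(\<lambda>(u, k). edge_label u k) ` S \<subseteq> T"
    and inj: "\<And>u k l. (u, k) \<in> S \<Longrightarrow> (u, l) \<in> S \<Longrightarrow> edge_label u k = edge_label u l \<Longrightarrow> k = l"
    and E: "\<And>L. E L = {u. \<exists>k. (u, k) \<in> S \<and> edge_label u k = L}"
  shows "(\<Sum>(u, k)\<in>S. int (m u) * h (edge_label u k)) = (\<Sum>L\<in>T. h L * int (\<Sum>u\<in>E L. m u))"
proof -
  have "(\<Sum>(u, k)\<in>S. int (m u) * h (edge_label u k)) =
      (\<Sum>L\<in>T. \<Sum>(u, k)\<in>{x \<in> S. (\<lambda>(u, k). edge_label u k) x = L}. int (m u) * h (edge_label u k))"
    using S by (rule sum.group[symmetric])
  also have "\<dots> = (\<Sum>L\<in>T. h L * int (\<Sum>u\<in>E L. m u))"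
  proof (rule sum.cong[OF refl])
    fix L
    let ?SL = "{x \<in> S. (\<lambda>(u, k). edge_label u k) x = L}"
    have "(\<Sum>(u, k)\<in>?SL. int (m u) * h (edge_label u k)) = (\<Sum>x\<in>?SL. h L * int (m (fst x)))"
      by (rule sum.cong) auto
    also have "\<dots> = (\<Sum>u\<in>fst ` ?SL. h L * int (m u))"
      by (rule sum.reindex_cong[symmetric, of fst]) (use inj in \<open>auto simp: inj_on_def\<close>)
    also have "fst ` ?SL = E L" unfolding E by force
    finally show "(\<Sum>(u, k)\<in>?SL. int (m u) * h (edge_label u k)) = h L * int (\<Sum>u\<in>E L. m u)"
      by (simp add: sum_distrib_left)
  qed
  finally show ?thesis .
qed

text \<open>Unnormalised natural weights cover both distributions: weight \<open>1\<close>, and the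
  number of maximal chains through a word.\<close>

lemma sum_ddeg_toggle_symmetric:
  fixes m :: "(nat \<Rightarrow> nat) \<Rightarrow> nat"
  assumes sym: "\<And>L. (\<Sum>u\<in>up_edges L. m u) = (\<Sum>u\<in>down_edges L. m u)"
  shows "(card rows + card cols) * (\<Sum>u\<in>W. m u * ddeg W (weak_le n) u) =
    card rows * card cols * (\<Sum>u\<in>W. m u)"
proof -
  let ?lab = "\<lambda>(u, k). edge_label u k"
  let ?T = "?lab ` (up_steps \<union> down_steps)"
  let ?c = "int (card rows) + int (card cols)"
  have inj: "k = l" if "u permutes {1..n}" "u k = u l" for u :: "nat \<Rightarrow> nat" and k l
    using that permutes_inj by (auto dest: injD)
  have up: "(\<Sum>(u, k)\<in>up_steps. int (m u) * h (edge_label u k)) = (\<Sum>L\<in>?T. h L * int (\<Sum>u\<in>up_edges L. m u))" for h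
  proof (rule sum_steps)
    show "k = l" if "(u, k) \<in> up_steps" "(u, l) \<in> up_steps" "edge_label u k = edge_label u l" for u k l
      using that inj[of u k l] by (auto simp: up_steps_def edge_label_def Let_def W_iff)
    show "up_edges L = {u. \<exists>k. (u, k) \<in> up_steps \<and> edge_label u k = L}" for L
      by (auto simp: up_steps_def up_edges_def)
  qed (use finite_steps in auto)
  have down: "(\<Sum>(u, k)\<in>down_steps. int (m u) * h (edge_label u k)) = (\<Sum>L\<in>?T. h L * int (\<Sum>u\<in>down_edges L. m u))" for h
  proof (rule sum_steps)
    show "k = l" if "(u, k) \<in> down_steps" "(u, l) \<in> down_steps" "edge_label u k = edge_label u l" for u k l
      using that inj[of u k l] by (auto simp: down_steps_def edge_label_def Let_def W_iff)
    show "down_edges L = {u. \<exists>k. (u, k) \<in> down_steps \<and> edge_label u k = L}" for L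
      by (auto simp: down_steps_def down_edges_def)
  qed (use finite_steps in auto)
  have fin: "finite {k. 1 \<le> k \<and> k < n \<and> Q k}" for Q
    by (rule finite_subset[of _ "{..n}"]) auto
  have "int (card rows * card cols * (\<Sum>u\<in>W. m u)) = (\<Sum>u\<in>W. int (m u) * (\<Sum>k=1..<n. gap_value u k))"
  proof -
    have "int (card rows * card cols * (\<Sum>u\<in>W. m u)) = (\<Sum>u\<in>W. int (m u) * (int (card rows) * int (card cols)))"
      by (simp add: sum_distrib_left mult_ac)
    also have "\<dots> = (\<Sum>u\<in>W. int (m u) * (\<Sum>k=1..<n. gap_value u k))"
      by (rule sum.cong) (simp_all only: sum_gap_value)
    finally show ?thesis .
  qed
  also have "\<dots> = (\<Sum>u\<in>W. (\<Sum>k | 1 \<le> k \<and> k < n \<and> u (Suc k) < u k. int (m u) * static_value (edge_label u k)) +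
    (\<Sum>k | 1 \<le> k \<and> k < n \<and> u k < u (Suc k) \<and> (u k, u (Suc k)) \<in> vinv n w.
       int (m u) * (?c - static_value (edge_label u k))))"
    by (rule sum.cong) (simp_all only: sum_gap_value_split sum_distrib_left distrib_left)
  also have "\<dots> = (\<Sum>(u, k)\<in>down_steps. int (m u) * static_value (edge_label u k)) +
      (\<Sum>(u, k)\<in>up_steps. int (m u) * (?c - static_value (edge_label u k)))"
    unfolding sum.distrib down_steps_def up_steps_def
    by (subst (1 2) sum.Sigma) (use finite_W fin in auto)
  \<comment> \<open>The factor besides \<open>m u\<close> depends on the label alone, so symmetry
    moves the sum to downward edges, where it meets the sum of the static values.\<close>
  also have "(\<Sum>(u, k)\<in>up_steps. int (m u) * (?c - static_value (edge_label u k))) =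
      (\<Sum>(u, k)\<in>down_steps. int (m u) * (?c - static_value (edge_label u k)))"
    using up[of "\<lambda>L. ?c - static_value L"] down[of "\<lambda>L. ?c - static_value L"] by (simp add: sym)
  also have "(\<Sum>(u, k)\<in>down_steps. int (m u) * static_value (edge_label u k)) + \<dots> =
      (\<Sum>(u, k)\<in>down_steps. int (m u) * ?c)"
    unfolding sum.distrib[symmetric] by (rule sum.cong) (auto simp: algebra_simps)
  also have "\<dots> = (\<Sum>u\<in>W. int (m u) * ?c * int (ddeg W (weak_le n) u))"
    unfolding down_steps_def
    by (subst sum.Sigma[symmetric]) (use finite_W fin in \<open>auto simp: ddeg_eq mult_ac intro!: sum.cong\<close>)
  also have "\<dots> = int ((card rows + card cols) * (\<Sum>u\<in>W. m u * ddeg W (weak_le n) u))"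
    by (simp add: sum_distrib_left mult_ac)
  finally show ?thesis by linarith
qed

lemma expectation_eq:
  fixes m :: "(nat \<Rightarrow> nat) \<Rightarrow> nat"
  assumes sym: "\<And>L. (\<Sum>u\<in>up_edges L. m u) = (\<Sum>u\<in>down_edges L. m u)"
    and pos: "(\<Sum>u\<in>W. m u) > 0" and rows: "card rows > 0"
  shows "(\<Sum>u\<in>W. real (m u) * real (ddeg W (weak_le n) u)) / real (\<Sum>u\<in>W. m u) =
    real (card rows * card cols) / real (card rows + card cols)"
proof -
  have "real (card rows + card cols) * (\<Sum>u\<in>W. real (m u) * real (ddeg W (weak_le n) u)) =
      real (card rows * card cols) * real (\<Sum>u\<in>W. m u)"
    using arg_cong[OF sum_ddeg_toggle_symmetric[OF sym], of real] by simp
  moreover have "real (\<Sum>u\<in>W. m u) > 0" "real (card rows + card cols) > 0"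
    using pos rows by (simp_all only: of_nat_0_less_iff)
  moreover have "x / s = p / q" if "q * x = p * s" "s > 0" "q > 0" for x s p q :: real
    using that by (simp add: frac_eq_eq mult.commute)
  ultimately show ?thesis by blast
qed

lemma expect_uni:
  assumes "card rows > 0"
  shows "expect_ddeg W (weak_le n) (uni_distr W) =
    real (card rows * card cols) / real (card rows + card cols)"
proof -
  have "expect_ddeg W (weak_le n) (uni_distr W) = (\<Sum>u\<in>W. real (ddeg W (weak_le n) u)) / real (card W)"
    unfolding expect_ddeg_def uni_distr_def
    by (rule integral_pmf_of_set) (use finite_W id_in_W in auto)
  then show ?thesis
    using expectation_eq[of "\<lambda>_. 1"] card_up_edges assms finite_W id_in_W by (auto simp: card_gt_0_iff)
qed

lemma expect_maxchain:
  assumes "card rows > 0"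
  shows "expect_ddeg W (weak_le n) (maxchain_distr W (weak_le n)) =
    real (card rows * card cols) / real (card rows + card cols)"
proof -
  let ?le = "weak_le n"
  let ?M = "\<lambda>u. {C. pred_on.maxchain W ?le C \<and> u \<in> C}"
  have finM: "finite (?M u)" for u
    by (rule finite_subset[OF _ finite_maxchains[OF finite_W]]) auto
  have M_id: "?M id \<noteq> {}" using ex_maxchain_through[OF finite_W id_in_W] by auto
  have "card (?M id) > 0" using finM M_id by (simp add: card_gt_0_iff)
  then have pos: "(\<Sum>u\<in>W. card (?M u)) > 0"
    by (rule sum_pos2[OF finite_W id_in_W]) simp
  have "set_pmf (maxchain_distr W ?le) \<subseteq> W"
  proof -
    have "finite (SIGMA u:W. ?M u)" "(SIGMA u:W. ?M u) \<noteq> {}"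
      using finite_W finM M_id id_in_W by auto
    then show ?thesis by (auto simp: maxchain_distr_def set_pmf_of_set)
  qed
  then have "expect_ddeg W ?le (maxchain_distr W ?le) =
      (\<Sum>u\<in>W. real (ddeg W ?le u) * pmf (maxchain_distr W ?le) u)"
    unfolding expect_ddeg_def by (intro integral_measure_pmf_real finite_W) auto
  also have "\<dots> = (\<Sum>u\<in>W. real (card (?M u)) * real (ddeg W ?le u)) / real (\<Sum>u\<in>W. card (?M u))"
    unfolding sum_divide_distrib
    by (rule sum.cong) (simp_all add: pmf_maxchain_distr[OF finite_W])
  also have "\<dots> = real (card rows * card cols) / real (card rows + card cols)"
    by (rule expectation_eq[OF sum_maxchains_up_edges pos assms])
  finally show ?thesis .
qed

end

section \<open>Balanced skew shapes\<close>

lemma mem_box_square: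
  "(x, y) \<in> box_square (i, j) \<longleftrightarrow> real_of_int i - 1 \<le> x \<and> x \<le> real_of_int i \<and>
     real_of_int j - 1 \<le> y \<and> y \<le> real_of_int j"
  by (auto simp: box_square_def)

lemma not_in_diagram_region:
  assumes "(i, j) \<notin> \<sigma>" "real_of_int i - 1 < x" "x < real_of_int i" "real_of_int j - 1 < y" "y < real_of_int j"
  shows "(x, y) \<notin> diagram_region \<sigma>"
proof
  assume "(x, y) \<in> diagram_region \<sigma>"
  then obtain k l where kl: "(k, l) \<in> \<sigma>" "(x, y) \<in> box_square (k, l)"
    by (auto simp: diagram_region_def)
  then have "k = i" "l = j" using assms by (auto simp: mem_box_square)
  with kl assms show False by simp
qed

text \<open>The point lies in the region, yet arbitrarily small diagonal steps leave it; the sign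
  \<open>s\<close> selects the southeast or the northwest direction.\<close>

lemma in_frontier_diagram_region:
  assumes box: "c \<in> \<sigma>" "(x, y) \<in> box_square c"
    and near: "\<And>\<delta>. 0 < \<delta> \<Longrightarrow> \<delta> \<le> 1 / 4 \<Longrightarrow> (x + s * \<delta>, y + s * \<delta>) \<notin> diagram_region \<sigma>"
    and s: "\<bar>s\<bar> = 1"
  shows "(x, y) \<in> frontier (diagram_region \<sigma>)"
proof -
  have "(x, y) \<in> diagram_region \<sigma>" using box by (auto simp: diagram_region_def)
  moreover have "(x, y) \<notin> interior (diagram_region \<sigma>)"
  proof
    assume "(x, y) \<in> interior (diagram_region \<sigma>)"
    then obtain e where e: "e > 0" "ball (x, y) e \<subseteq> diagram_region \<sigma>"
      by (auto simp: mem_interior)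
    define \<delta> where "\<delta> = min (e / 4) (1 / 4)"
    have \<delta>: "0 < \<delta>" "\<delta> \<le> 1 / 4" "\<delta> \<le> e / 4" using e by (auto simp: \<delta>_def)
    have "dist (x, y) (x + s * \<delta>, y + s * \<delta>) \<le> \<bar>s * \<delta>\<bar> + \<bar>s * \<delta>\<bar>"
      using sqrt_sum_squares_le_sum_abs[of "s * \<delta>" "s * \<delta>"]
      by (simp add: dist_Pair_Pair dist_real_def)
    also have "\<dots> < e" using \<delta> s e by (simp add: abs_mult)
    finally show False using e near[OF \<delta>(1,2)] by auto
  qed
  ultimately show ?thesis by (simp add: frontier_def closure_subset[THEN subsetD])
qed

lemma in_closed_segment_Pair:
  fixes x y x' y' :: real
  assumes "z \<in> closed_segment (x, y) (x', y')"
  obtains u where "0 \<le> u" "u \<le> 1" "z = (x + u * (x' - x), y + u * (y' - y))"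
  using assms by (auto simp: in_segment algebra_simps)

text \<open>For \<open>d = 0\<close> the missing box lies northwest of the lattice point, for \<open>d = 1\<close> southeast.\<close>

lemma outward_corner_lattice:
  fixes p q d :: int
  assumes d: "d = 0 \<or> d = 1"
    and missing: "(p + d, q + d) \<notin> \<sigma>"
    and boxes: "(p + d, q + 1 - d) \<in> \<sigma>" "(p + 1 - d, q + d) \<in> \<sigma>"
  shows "outward_corner \<sigma> (real_of_int p, real_of_int q)"
proof -
  \<comment> \<open>The direction from the lattice point to the missing box.\<close>
  define s where "s = 2 * real_of_int d - 1"
  have s: "\<bar>s\<bar> = 1" using d by (auto simp: s_def)
  let ?x = "(real_of_int p, real_of_int q)"
  \<comment> \<open>Arms of length \<open>1/2\<close> together with diagonal steps of at most
    \<open>1/4\<close> stay inside the open square of the missing box.\<close>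
  let ?y = "(p + s / 2, real_of_int q)" and ?z = "(real_of_int p, q + s / 2)"
  have seg_y: "\<exists>t. 0 \<le> t \<and> t \<le> 1 / 2 \<and> v = (p + s * t, real_of_int q)" if "v \<in> closed_segment ?x ?y" for v
    using that by (elim in_closed_segment_Pair) (auto intro!: exI[of _ "_ / 2"])
  have seg_z: "\<exists>t. 0 \<le> t \<and> t \<le> 1 / 2 \<and> v = (real_of_int p, q + s * t)" if "v \<in> closed_segment ?x ?z" for v
    using that by (elim in_closed_segment_Pair) (auto intro!: exI[of _ "_ / 2"])
  have "\<not> collinear {?x, ?y, ?z}"
  proof -
    have "collinear {?x, ?y, ?z} \<longleftrightarrow> collinear {?y, ?x, ?z}" by (simp add: insert_commute)
    also have "\<dots> \<longleftrightarrow> collinear {0, ?y - ?x, ?z - ?x}" by (rule collinear_3) (simp add: NO_MATCH_def)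
    finally have iff: "collinear {?x, ?y, ?z} \<longleftrightarrow> collinear {0, ?y - ?x, ?z - ?x}" .
    show ?thesis unfolding iff collinear_lemma using s by (auto simp: prod_eq_iff)
  qed
  moreover have "closed_segment ?x ?y \<subseteq> frontier (diagram_region \<sigma>)"
  proof
    fix v assume "v \<in> closed_segment ?x ?y"
    then obtain t where t: "0 \<le> t" "t \<le> 1 / 2" "v = (p + s * t, real_of_int q)" using seg_y by blast
    show "v \<in> frontier (diagram_region \<sigma>)"
      unfolding t(3)
    proof (rule in_frontier_diagram_region[OF boxes(1) _ _ s])
      show "(p + s * t, real_of_int q) \<in> box_square (p + d, q + 1 - d)"
        using d t by (auto simp: mem_box_square s_def)
      fix \<delta> :: real assume \<delta>: "0 < \<delta>" "\<delta> \<le> 1 / 4"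
      show "(p + s * t + s * \<delta>, q + s * \<delta>) \<notin> diagram_region \<sigma>"
        using d t \<delta> by (intro not_in_diagram_region[OF missing]) (auto simp: s_def)
    qed
  qed
  moreover have "closed_segment ?x ?z \<subseteq> frontier (diagram_region \<sigma>)"
  proof
    fix v assume "v \<in> closed_segment ?x ?z"
    then obtain t where t: "0 \<le> t" "t \<le> 1 / 2" "v = (real_of_int p, q + s * t)" using seg_z by blast
    show "v \<in> frontier (diagram_region \<sigma>)"
      unfolding t(3)
    proof (rule in_frontier_diagram_region[OF boxes(2) _ _ s])
      show "(real_of_int p, q + s * t) \<in> box_square (p + 1 - d, q + d)"
        using d t by (auto simp: mem_box_square s_def)
      fix \<delta> :: real assume \<delta>: "0 < \<delta>" "\<delta> \<le> 1 / 4"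
      show "(p + s * \<delta>, q + s * t + s * \<delta>) \<notin> diagram_region \<sigma>"
        using d t \<delta> by (intro not_in_diagram_region[OF missing]) (auto simp: s_def)
    qed
  qed
  moreover have "\<not> (box_square c \<inter> (closed_segment ?x ?y - {?x}) \<noteq> {} \<and>
      box_square c \<inter> (closed_segment ?x ?z - {?x}) \<noteq> {})" if "c \<in> \<sigma>" for c
  proof
    obtain i j where c: "c = (i, j)" by (cases c)
    assume *: "box_square c \<inter> (closed_segment ?x ?y - {?x}) \<noteq> {} \<and>
      box_square c \<inter> (closed_segment ?x ?z - {?x}) \<noteq> {}"
    then obtain t where t: "0 \<le> t" "t \<le> 1 / 2" "(p + s * t, real_of_int q) \<in> box_square (i, j)" "t \<noteq> 0"
      using seg_y unfolding c by fastforce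
    \<comment> \<open>Meeting both arms away from the corner forces the row and the column of the
      missing box.\<close>
    have i: "i = p + d" using d t by (auto simp: mem_box_square s_def)
    obtain t' where t': "0 \<le> t'" "t' \<le> 1 / 2" "(real_of_int p, q + s * t') \<in> box_square (i, j)" "t' \<noteq> 0"
      using * seg_z unfolding c by fastforce
    have "j = q + d" using d t' by (auto simp: mem_box_square s_def)
    then show False using that i missing c by simp
  qed
  ultimately show ?thesis unfolding outward_corner_def by blast
qed

lemma main_antidiagonal_imp:
  assumes "(x, y) \<in> main_antidiagonal a b"
  shows "real b * x + real a * y = real a * real b"
proof -
  obtain u v where uv: "u + v = 1" "(x, y) = u *\<^sub>R (0, real b) + v *\<^sub>R (real a, 0)"
    using assms unfolding main_antidiagonal_def affine_hull_2 by blast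
  have "real b * x + real a * y = (u + v) * (real a * real b)"
    using uv(2) by (simp add: algebra_simps)
  then show ?thesis using uv by simp
qed

section \<open>Order convexity and connectedness\<close>

definition order_convex :: "(int \<times> int) set \<Rightarrow> bool" where
  "order_convex \<sigma> \<longleftrightarrow> (\<forall>i j i' j' r c. (i, j) \<in> \<sigma> \<longrightarrow> (i', j') \<in> \<sigma> \<longrightarrow>
     i \<le> r \<longrightarrow> r \<le> i' \<longrightarrow> j \<le> c \<longrightarrow> c \<le> j' \<longrightarrow> (r, c) \<in> \<sigma>)"

lemma order_convexD:
  "order_convex \<sigma> \<Longrightarrow> (i, j) \<in> \<sigma> \<Longrightarrow> (i', j') \<in> \<sigma> \<Longrightarrow> i \<le> r \<Longrightarrow> r \<le> i' \<Longrightarrow> j \<le> c \<Longrightarrow> c \<le> j' \<Longrightarrow> (r, c) \<in> \<sigma>"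
  unfolding order_convex_def by blast

lemma young_diagram_iff:
  "(i, j) \<in> young_diagram lam \<longleftrightarrow> 1 \<le> i \<and> i \<le> int (length lam) \<and> 1 \<le> j \<and> j \<le> int (lam ! (nat i - 1))"
proof
  assume "1 \<le> i \<and> i \<le> int (length lam) \<and> 1 \<le> j \<and> j \<le> int (lam ! (nat i - 1))"
  then show "(i, j) \<in> young_diagram lam"
    unfolding young_diagram_def by (intro CollectI exI[of _ "nat i"] exI[of _ "nat j"]) auto
qed (auto simp: young_diagram_def)

lemma young_diagram_down:
  assumes "is_partition lam" "(i, j) \<in> young_diagram lam" "1 \<le> r" "r \<le> i" "1 \<le> c" "c \<le> j"
  shows "(r, c) \<in> young_diagram lam"
proof -
  have "lam ! (nat i - 1) \<le> lam ! (nat r - 1)"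
  proof (cases "r = i")
    case False
    then show ?thesis
      using assms by (intro sorted_wrt_nth_less[of "(\<ge>)" lam, simplified])
        (auto simp: is_partition_def young_diagram_iff)
  qed simp
  then show ?thesis using assms by (auto simp: young_diagram_iff)
qed

lemma order_convex_skew_shape:
  assumes "is_partition lam" "is_partition nu"
  shows "order_convex (skew_shape lam nu)"
  unfolding order_convex_def skew_shape_def
proof (intro allI impI)
  fix i j i' j' r c
  assume *: "(i, j) \<in> young_diagram lam - young_diagram nu" "(i', j') \<in> young_diagram lam - young_diagram nu"
    "i \<le> r" "r \<le> i'" "j \<le> c" "c \<le> j'"
  then have pos: "1 \<le> i" "1 \<le> j" by (auto simp: young_diagram_iff)
  then have "(r, c) \<in> young_diagram lam"
    using * young_diagram_down[OF assms(1), of i' j' r c] by auto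
  moreover have "(r, c) \<notin> young_diagram nu"
    using * pos young_diagram_down[OF assms(2), of r c i j] by auto
  ultimately show "(r, c) \<in> young_diagram lam - young_diagram nu" by simp
qed

text \<open>No cover relation crosses the level \<open>m\<close>, so the side is constant along
  paths in the Hasse diagram. The function \<open>h\<close> will be the row or the column
  index.\<close>

lemma connected_diagram_side:
  assumes conn: "connected_diagram \<sigma>"
    and mono: "\<And>x y. box_le x y \<Longrightarrow> h x \<le> h y"
    and cut: "\<And>x y. x \<in> \<sigma> \<Longrightarrow> y \<in> \<sigma> \<Longrightarrow> box_le x y \<Longrightarrow> h x \<le> m \<Longrightarrow> m < (h y :: int) \<Longrightarrow> False"
    and xy: "x \<in> \<sigma>" "y \<in> \<sigma>" "h x \<le> m"
  shows "h y \<le> m"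
proof -
  have step: "h x \<le> m \<longleftrightarrow> h y \<le> m" if "covered_by \<sigma> box_le x y" for x y
  proof -
    have "x \<in> \<sigma>" "y \<in> \<sigma>" "box_le x y" using that by (auto simp: covered_by_def)
    then show ?thesis using mono[of x y] cut[of x y] by (cases "m < h y") auto
  qed
  have "equivclp (covered_by \<sigma> box_le) x y"
    using conn xy by (auto simp: connected_diagram_def)
  then show ?thesis
    by (induction rule: equivclp_induct) (use xy step in auto)
qed

lemma connected_rows:
  assumes conn: "connected_diagram \<sigma>" and conv: "order_convex \<sigma>"
    and "(i, j) \<in> \<sigma>" "(i', j') \<in> \<sigma>" "i \<le> m" "m < i'"
  shows "\<exists>c. (m, c) \<in> \<sigma> \<and> (m + 1, c) \<in> \<sigma>"
proof (rule ccontr)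
  assume *: "\<not> ?thesis"
  have "fst (i', j') \<le> m"
  proof (rule connected_diagram_side[OF conn, of fst])
    fix x y assume "x \<in> \<sigma>" "y \<in> \<sigma>" "box_le x y" "fst x \<le> m" "m < fst y"
    \<comment> \<open>By convexity the column of \<open>x\<close> continues downwards to the row of
      \<open>y\<close>, passing from row \<open>m\<close> to row \<open>m + 1\<close>.\<close>
    then have "(m, snd x) \<in> \<sigma>" "(m + 1, snd x) \<in> \<sigma>"
      using order_convexD[OF conv, of "fst x" "snd x" "fst y" "snd y" _ "snd x"] by (auto simp: box_le_def)
    then show False using * by blast
  qed (use assms in \<open>auto simp: box_le_def\<close>)
  then show False using assms by simp
qed

lemma connected_columns:
  assumes conn: "connected_diagram \<sigma>" and conv: "order_convex \<sigma>"
    and "(i, j) \<in> \<sigma>" "(i', j') \<in> \<sigma>" "j \<le> m" "m < j'"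
  shows "\<exists>r. (r, m) \<in> \<sigma> \<and> (r, m + 1) \<in> \<sigma>"
proof (rule ccontr)
  assume *: "\<not> ?thesis"
  have "snd (i', j') \<le> m"
  proof (rule connected_diagram_side[OF conn, of snd])
    fix x y assume "x \<in> \<sigma>" "y \<in> \<sigma>" "box_le x y" "snd x \<le> m" "m < snd y"
    then have "(fst x, m) \<in> \<sigma>" "(fst x, m + 1) \<in> \<sigma>"
      using order_convexD[OF conv, of "fst x" "snd x" "fst y" "snd y" "fst x"] by (auto simp: box_le_def)
    then show False using * by blast
  qed (use assms in \<open>auto simp: box_le_def\<close>)
  then show False using assms by simp
qed

lemma mem_translate: "(i, j) \<in> translate v \<sigma> \<longleftrightarrow> (i - fst v, j - snd v) \<in> \<sigma>"
  by (cases v) (force simp: translate_def image_iff)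

lemma has_height_width_unique:
  "has_height_width \<sigma> a b \<Longrightarrow> has_height_width \<sigma> a' b' \<Longrightarrow> a = a' \<and> b = b'"
  unfolding has_height_width_def by (meson order_antisym)

section \<open>Row balance of a balanced shape\<close>

locale balanced_shape =
  fixes \<sigma> :: "(int \<times> int) set" and a b :: nat
  assumes in_rectangle: "\<sigma> \<subseteq> rectangle a b"
    and convex: "order_convex \<sigma>"
    and nonempty: "\<sigma> \<noteq> {}"
    and row_nonempty: "1 \<le> i \<Longrightarrow> i \<le> int a \<Longrightarrow> \<exists>c. (i, c) \<in> \<sigma>"
    and col_nonempty: "1 \<le> j \<Longrightarrow> j \<le> int b \<Longrightarrow> \<exists>r. (r, j) \<in> \<sigma>"
    and rows_meet: "1 \<le> i \<Longrightarrow> i < int a \<Longrightarrow> \<exists>c. (i, c) \<in> \<sigma> \<and> (i + 1, c) \<in> \<sigma>"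
    and corner: "outward_corner \<sigma> x \<Longrightarrow> x \<in> main_antidiagonal a b"
begin

lemma mem_bounds: "(i, j) \<in> \<sigma> \<Longrightarrow> 1 \<le> i \<and> i \<le> int a \<and> 1 \<le> j \<and> j \<le> int b"
  using in_rectangle by (auto simp: rectangle_def)

lemma corner_eq:
  assumes "d = 0 \<or> d = 1" "(p + d, q + d) \<notin> \<sigma>" "(p + d, q + 1 - d) \<in> \<sigma>" "(p + 1 - d, q + d) \<in> \<sigma>"
  shows "int b * p + int a * q = int a * int b"
proof -
  have "real b * real_of_int p + real a * real_of_int q = real a * real b"
    by (intro main_antidiagonal_imp corner outward_corner_lattice[OF assms])
  then have "real_of_int (int b * p + int a * q) = real_of_int (int a * int b)" by simp
  then show ?thesis by (simp only: of_int_eq_iff)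
qed

definition row :: "int \<Rightarrow> int set" where "row i = {c. (i, c) \<in> \<sigma>}"

text \<open>One less than the first column, so that \<open>(i, left i)\<close> and
  \<open>(i, right i)\<close> are the lattice points at the ends of the lower edge of row
  \<open>i\<close>.\<close>

definition left :: "int \<Rightarrow> int" where "left i = Min (row i) - 1"

definition right :: "int \<Rightarrow> int" where "right i = Max (row i)"

lemma row_props:
  assumes "1 \<le> i" "i \<le> int a"
  shows "row i = {left i + 1..right i}" "left i < right i" "0 \<le> left i" "right i \<le> int b"
proof -
  have "row i \<subseteq> {1..int b}" using mem_bounds by (auto simp: row_def)
  then have fin: "finite (row i)" by (rule finite_subset) simp
  have ne: "row i \<noteq> {}" using row_nonempty[OF assms] by (auto simp: row_def)
  have m: "left i + 1 \<in> row i" "right i \<in> row i"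
    using fin ne by (auto simp: left_def right_def)
  show "row i = {left i + 1..right i}"
  proof
    show "row i \<subseteq> {left i + 1..right i}" using fin by (auto simp: left_def right_def)
    show "{left i + 1..right i} \<subseteq> row i"
      using m order_convexD[OF convex, of i "left i + 1" i "right i" i] by (auto simp: row_def)
  qed
  then show "left i < right i" using m by auto
  show "0 \<le> left i" "right i \<le> int b" using m mem_bounds by (force simp: row_def)+
qed

lemma mem_iff: "1 \<le> i \<Longrightarrow> i \<le> int a \<Longrightarrow> (i, c) \<in> \<sigma> \<longleftrightarrow> left i < c \<and> c \<le> right i"
proof -
  assume "1 \<le> i" "i \<le> int a"
  then have "c \<in> row i \<longleftrightarrow> c \<in> {left i + 1..right i}" using row_props(1)[of i] by (simp only:)
  then show ?thesis by (auto simp: row_def)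
qed

lemma antimono:
  assumes "1 \<le> i" "i \<le> k" "k \<le> int a"
  shows "left k \<le> left i" "right k \<le> right i"
proof -
  have i: "i \<le> int a" and k: "1 \<le> k" using assms by auto
  note mi = mem_iff[OF assms(1) i] and mk = mem_iff[OF k assms(3)]
  note pi = row_props[OF assms(1) i] and pk = row_props[OF k assms(3)]
  show "left k \<le> left i"
  proof (rule ccontr)
    assume neg: "\<not> ?thesis"
    then have "(k, left i + 1) \<in> \<sigma>"
      using order_convexD[OF convex, of i "left i + 1" k "right k" k "left i + 1"] mi mk pi pk assms by auto
    then show False using mk neg by auto
  qed
  show "right k \<le> right i"
  proof (rule ccontr)
    assume neg: "\<not> ?thesis"
    then have "(i, right k) \<in> \<sigma>"
      using order_convexD[OF convex, of i "right i" k "right k" i "right k"] mi mk pi pk assms by auto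
    then show False using mi neg by auto
  qed
qed

text \<open>Consecutive rows share a column. At the corners found below, this supplies one of the
  two boxes that \<open>corner_eq\<close> asks for.\<close>

lemma left_less_right_Suc:
  assumes "1 \<le> i" "i < int a"
  shows "left i < right (i + 1)"
proof -
  obtain c where "(i, c) \<in> \<sigma>" "(i + 1, c) \<in> \<sigma>" using rows_meet[OF assms] by blast
  then show ?thesis using assms mem_iff[of i c] mem_iff[of "i + 1" c] by auto
qed

lemma initial_segment:
  assumes "\<And>s t. t \<in> S \<Longrightarrow> 1 \<le> s \<Longrightarrow> s \<le> t \<Longrightarrow> s \<in> S" "S \<subseteq> {1..int a}"
  obtains p where "S = {1..p}" "0 \<le> p" "p \<le> int a"
proof (cases "S = {}")
  case True then show ?thesis using that[of 0] by simp
next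
  case False
  have fin: "finite S" using assms(2) by (rule finite_subset) simp
  have "Max S \<in> S" using fin False by simp
  then have "S = {1..Max S}" using assms fin by (auto intro: Max_ge)
  then show ?thesis using that[of "Max S"] \<open>Max S \<in> S\<close> assms(2) by auto
qed

text \<open>Below the last row that does not start before row \<open>r\<close> there is either a northwest outward
  corner or the southwest corner of the rectangle; in both cases a point of the antidiagonal.\<close>

lemma corner_left:
  assumes r: "1 \<le> r" "r \<le> int a"
  obtains p where "{t \<in> {1..int a}. left r \<le> left t} = {1..p}" "int b * p + int a * left r = int a * int b"
    "r \<le> p" "p \<le> int a"
proof -
  obtain p where p: "{t \<in> {1..int a}. left r \<le> left t} = {1..p}" "0 \<le> p" "p \<le> int a"
  proof (rule initial_segment[of "{t \<in> {1..int a}. left r \<le> left t}"])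
    show "s \<in> {t \<in> {1..int a}. left r \<le> left t}" if "t \<in> {t \<in> {1..int a}. left r \<le> left t}" "1 \<le> s" "s \<le> t" for s t
      using that antimono(1)[of s t] by auto
  qed auto
  have rp: "r \<le> p" using p(1) r by (auto simp: set_eq_iff)
  have "int b * p + int a * left r = int a * int b"
  proof (cases "p = int a")
    case True
    have "1 \<le> int b" using mem_bounds nonempty by force
    then obtain t where t: "(t, 1) \<in> \<sigma>" using col_nonempty[of 1] by auto
    then have t1: "1 \<le> t" "t \<le> int a" using mem_bounds by auto
    then have "left t \<le> 0" using t mem_iff by auto
    moreover have "left r \<le> left t" using p(1) True t1 by (auto simp: set_eq_iff)
    ultimately have "left r = 0" using row_props(3)[OF r] by simp
    then show ?thesis using True by simp
  next
    case False
    then have p1: "1 \<le> p" "p + 1 \<le> int a" using p rp r by auto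
    have "left r \<le> left p" using p(1) p1 by (auto simp: set_eq_iff)
    then have eq: "left p = left r" using antimono(1)[OF r(1) rp p(3)] by simp
    have "p + 1 \<notin> {t \<in> {1..int a}. left r \<le> left t}" unfolding p(1) by simp
    then have "\<not> left r \<le> left (p + 1)" using p1 by auto
    moreover have "left p < right (p + 1)" using left_less_right_Suc[of p] p1 by simp
    ultimately show ?thesis
      using corner_eq[of 0 p "left r"] mem_iff[of p] mem_iff[of "p + 1"] p1 eq row_props(2)[of p] by auto
  qed
  then show ?thesis using that p rp by blast
qed

text \<open>The counterpart of \<open>corner_left\<close> under a half-turn: below the last row
  reaching further right than row \<open>r\<close> there is a southeast outward corner; without such
  a row the point is the northeast corner of the rectangle.\<close>

lemma corner_right:
  assumes r: "1 \<le> r" "r \<le> int a"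
  obtains p where "{t \<in> {1..int a}. right r < right t} = {1..p}" "int b * p + int a * right r = int a * int b"
    "0 \<le> p"
proof -
  obtain p where p: "{t \<in> {1..int a}. right r < right t} = {1..p}" "0 \<le> p" "p \<le> int a"
  proof (rule initial_segment[of "{t \<in> {1..int a}. right r < right t}"])
    show "s \<in> {t \<in> {1..int a}. right r < right t}" if "t \<in> {t \<in> {1..int a}. right r < right t}" "1 \<le> s" "s \<le> t" for s t
      using that antimono(2)[of s t] by auto
  qed auto
  have "r \<notin> {1..p}" unfolding p(1)[symmetric] by simp
  then have rp: "p + 1 \<le> r" using r by auto
  have "int b * p + int a * right r = int a * int b"
  proof (cases "p = 0")
    case True
    have "1 \<le> int b" using mem_bounds nonempty by force
    then obtain t where t: "(t, int b) \<in> \<sigma>" using col_nonempty[of "int b"] by auto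
    then have t1: "1 \<le> t" "t \<le> int a" using mem_bounds by auto
    then have "int b \<le> right t" using t mem_iff by auto
    moreover have "\<not> right r < right t" using p(1) True t1 by (auto simp: set_eq_iff)
    ultimately have "right r = int b" using row_props(4)[OF r] by simp
    then show ?thesis using True by simp
  next
    case False
    then have p1: "1 \<le> p" "p + 1 \<le> int a" using p rp r by auto
    have "p \<in> {t \<in> {1..int a}. right r < right t}" unfolding p(1) using p1 by simp
    then have lt: "right r < right p" by simp
    have "p + 1 \<notin> {t \<in> {1..int a}. right r < right t}" unfolding p(1) by simp
    then have "right (p + 1) \<le> right r" using p1 by auto
    then have eq: "right (p + 1) = right r" using antimono(2)[of "p + 1" r] rp r p1 by simp
    have "left p < right (p + 1)" using left_less_right_Suc[of p] p1 by simp
    then show ?thesis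
      using corner_eq[of 1 p "right r"] mem_iff[of p] mem_iff[of "p + 1"] p1 eq lt row_props(2)[of "p + 1"] by auto
  qed
  then show ?thesis using that p by blast
qed

text \<open>The contained rows are those that start late enough, up to \<open>p\<close>, without
  those that end too late, up to \<open>p'\<close>. Subtracting the two antidiagonal equations
  compares their number with that of the common columns.\<close>

lemma card_rows_in_inter_le:
  assumes r: "1 \<le> r" "r \<le> s" "s \<le> int a"
  shows "int b * int (card {t \<in> {1..int a}. row t \<subseteq> row r \<inter> row s}) = int a * int (card (row r \<inter> row s))"
proof -
  have ra: "r \<le> int a" and s: "1 \<le> s" using r by auto
  have inter: "row r \<inter> row s = {left r + 1..right s}"
    using row_props(1)[OF r(1) ra] row_props(1)[OF s r(3)] antimono[OF r] by auto
  have sub: "row t \<subseteq> row r \<inter> row s \<longleftrightarrow> left r \<le> left t \<and> right t \<le> right s" if "1 \<le> t" "t \<le> int a" for t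
    unfolding inter row_props(1)[OF that] using row_props(2)[OF that] by auto
  obtain p where p: "{t \<in> {1..int a}. left r \<le> left t} = {1..p}" "int b * p + int a * left r = int a * int b"
    "r \<le> p" "p \<le> int a"
    using corner_left[OF r(1) ra] .
  obtain p' where p': "{t \<in> {1..int a}. right s < right t} = {1..p'}" "int b * p' + int a * right s = int a * int b"
    "0 \<le> p'"
    using corner_right[OF s r(3)] .
  have "{t \<in> {1..int a}. row t \<subseteq> row r \<inter> row s} =
      {t \<in> {1..int a}. left r \<le> left t \<and> right t \<le> right s}"
    by (rule Collect_cong, rule conj_cong[OF refl], rule sub) auto
  also have "\<dots> = {t \<in> {1..int a}. left r \<le> left t} - {t \<in> {1..int a}. right s < right t}"
    by auto
  also have "\<dots> = {p' + 1..p}" unfolding p(1) p'(1) using p'(3) by auto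
  finally have set: "{t \<in> {1..int a}. row t \<subseteq> row r \<inter> row s} = {p' + 1..p}" .
  have b: "0 < int b" "0 < int a" using mem_bounds nonempty r by force+
  have eq: "int b * (p - p') = int a * (right s - left r)"
    using p(2) p'(2) by (simp add: algebra_simps)
  \<comment> \<open>Being proportional, the two lengths have the same sign; if negative, both
    intervals are empty and both counts are \<open>0\<close>.\<close>
  have "0 \<le> p - p' \<longleftrightarrow> 0 \<le> right s - left r"
    using eq b by (metis zero_le_mult_iff not_less order.asym)
  then show ?thesis
    unfolding set unfolding inter using eq by auto
qed

lemma card_rows_in_inter:
  assumes "1 \<le> r" "r \<le> int a" "1 \<le> s" "s \<le> int a"
  shows "int b * int (card {t \<in> {1..int a}. row t \<subseteq> row r \<inter> row s}) = int a * int (card (row r \<inter> row s))"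
  using card_rows_in_inter_le[of r s] card_rows_in_inter_le[of s r] assms
  by (cases "r \<le> s") (simp_all add: Int_commute)

end

section \<open>Placing the shape, and matching it with the inversions of \<open>w\<close>\<close>

lemma ex_balanced_shape:
  assumes conv: "order_convex \<sigma>" and bal: "balanced \<sigma>" and hw: "has_height_width \<sigma> a b"
  obtains v where "balanced_shape (translate v \<sigma>) a b"
proof -
  have conn: "connected_diagram \<sigma>" using bal by (simp add: balanced_def)
  \<comment> \<open>Height and width are unique, so the sizes chosen inside \<open>balanced\<close>
    are the given ones.\<close>
  obtain v where v: "translate v \<sigma> \<subseteq> rectangle a b"
      "\<And>x. outward_corner (translate v \<sigma>) x \<Longrightarrow> x \<in> main_antidiagonal a b"
    using bal has_height_width_unique[OF hw] unfolding balanced_def by blast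
  let ?S = "translate v \<sigma>"
  have minimal: "a \<le> a' \<and> b \<le> b'" if "translate v' \<sigma> \<subseteq> rectangle a' b'" for v' a' b'
    using hw that unfolding has_height_width_def by blast
  have bounds: "1 \<le> i \<and> i \<le> int a \<and> 1 \<le> j \<and> j \<le> int b" if "(i, j) \<in> ?S" for i j
    using v(1) that by (auto simp: rectangle_def)
  obtain i0 j0 where "(i0, j0) \<in> \<sigma>" using conn by (auto simp: connected_diagram_def)
  then have ne: "(i0 + fst v, j0 + snd v) \<in> ?S" by (simp add: mem_translate)
  then have pos: "1 \<le> a" "1 \<le> b" using bounds by force+
  have shift: "(i + k, j + l) \<in> ?S" if "(i, j) \<in> translate (fst v - k, snd v - l) \<sigma>" for i j k l
    using that by (simp add: mem_translate algebra_simps)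
  \<comment> \<open>An empty border row or column would leave room for a smaller rectangle; on the
    first row and column the shape must also be shifted by one.\<close>
  have first_row: "\<exists>c. (1, c) \<in> ?S"
  proof (rule ccontr)
    assume *: "\<not> ?thesis"
    have "translate (fst v - 1, snd v - 0) \<sigma> \<subseteq> rectangle (a - 1) b"
    proof (unfold subset_iff split_paired_All, intro allI impI)
      fix i j assume "(i, j) \<in> translate (fst v - 1, snd v - 0) \<sigma>"
      then have m: "(i + 1, j + 0) \<in> ?S" by (rule shift)
      moreover have "i \<noteq> 0" using m * by auto
      ultimately show "(i, j) \<in> rectangle (a - 1) b"
        using bounds[OF m] pos by (auto simp: rectangle_def)
    qed
    then show False using minimal pos by fastforce
  qed
  have last_row: "\<exists>c. (int a, c) \<in> ?S"
  proof (rule ccontr)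
    assume *: "\<not> ?thesis"
    have "?S \<subseteq> rectangle (a - 1) b"
    proof (unfold subset_iff split_paired_All, intro allI impI)
      fix i j assume m: "(i, j) \<in> ?S"
      moreover have "i \<noteq> int a" using m * by auto
      ultimately show "(i, j) \<in> rectangle (a - 1) b"
        using bounds[OF m] pos by (auto simp: rectangle_def)
    qed
    then show False using minimal pos by fastforce
  qed
  have first_col: "\<exists>r. (r, 1) \<in> ?S"
  proof (rule ccontr)
    assume *: "\<not> ?thesis"
    have "translate (fst v - 0, snd v - 1) \<sigma> \<subseteq> rectangle a (b - 1)"
    proof (unfold subset_iff split_paired_All, intro allI impI)
      fix i j assume "(i, j) \<in> translate (fst v - 0, snd v - 1) \<sigma>"
      then have m: "(i + 0, j + 1) \<in> ?S" by (rule shift)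
      moreover have "j \<noteq> 0" using m * by auto
      ultimately show "(i, j) \<in> rectangle a (b - 1)"
        using bounds[OF m] pos by (auto simp: rectangle_def)
    qed
    then show False using minimal pos by fastforce
  qed
  have last_col: "\<exists>r. (r, int b) \<in> ?S"
  proof (rule ccontr)
    assume *: "\<not> ?thesis"
    have "?S \<subseteq> rectangle a (b - 1)"
    proof (unfold subset_iff split_paired_All, intro allI impI)
      fix i j assume m: "(i, j) \<in> ?S"
      moreover have "j \<noteq> int b" using m * by auto
      ultimately show "(i, j) \<in> rectangle a (b - 1)"
        using bounds[OF m] pos by (auto simp: rectangle_def)
    qed
    then show False using minimal pos by fastforce
  qed
  have meet: "\<exists>c. (i, c) \<in> ?S \<and> (i + 1, c) \<in> ?S" if i: "1 \<le> i" "i < int a" for i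
  proof -
    obtain c c' where "(1, c) \<in> ?S" "(int a, c') \<in> ?S" using first_row last_row by blast
    then obtain d where "(i - fst v, d) \<in> \<sigma>" "(i - fst v + 1, d) \<in> \<sigma>"
      using connected_rows[OF conn conv, of "1 - fst v" "c - snd v" "int a - fst v" "c' - snd v" "i - fst v"] i
      by (auto simp: mem_translate)
    then show ?thesis by (intro exI[of _ "d + snd v"]) (simp add: mem_translate algebra_simps)
  qed
  have col: "\<exists>r. (r, j) \<in> ?S" if j: "1 \<le> j" "j \<le> int b" for j
  proof (cases "j = int b")
    case False
    obtain r r' where "(r, 1) \<in> ?S" "(r', int b) \<in> ?S" using first_col last_col by blast
    then obtain d where "(d, j - snd v) \<in> \<sigma>"
      using connected_columns[OF conn conv, of "r - fst v" "1 - snd v" "r' - fst v" "int b - snd v" "j - snd v"] j False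
      by (auto simp: mem_translate)
    then show ?thesis by (intro exI[of _ "d + fst v"]) (simp add: mem_translate)
  qed (use last_col in simp)
  have "order_convex ?S"
    unfolding order_convex_def mem_translate
    by (intro allI impI, erule (1) order_convexD[OF conv]) auto
  moreover have "\<exists>c. (i, c) \<in> ?S" if "1 \<le> i" "i \<le> int a" for i
    using meet[of i] last_row that by (cases "i = int a") auto
  ultimately have "balanced_shape ?S a b"
    using v ne meet col by unfold_locales auto
  then show ?thesis by (rule that)
qed

lemma map_prod_translate:
  "map_prod ((+) (fst v)) ((+) (snd v)) ` \<sigma> = translate v \<sigma>"
  unfolding translate_def by (rule image_cong) (auto simp: prod_eq_iff)

lemma skew_vexillary_translate:
  assumes "skew_vexillary_of_shape n w \<sigma>"
  shows "skew_vexillary_of_shape n w (translate v \<sigma>)"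
proof -
  obtain f g where fg: "bij f" "bij g" "map_prod f g ` rothe_diagram n w = \<sigma>"
    using assms by (auto simp: skew_vexillary_of_shape_def)
  have "map_prod ((+) (fst v) \<circ> f) ((+) (snd v) \<circ> g) ` rothe_diagram n w = translate v \<sigma>"
    unfolding map_prod_translate[symmetric] fg(3)[symmetric] by (simp add: image_comp map_prod_compose)
  moreover have "bij ((+) (fst v) \<circ> f)" "bij ((+) (snd v) \<circ> g)"
    using fg by (auto intro!: bij_comp bij_plus)
  ultimately show ?thesis unfolding skew_vexillary_of_shape_def by blast
qed

text \<open>Numbers of contained rows and of common columns do not change under separate
  permutations of rows and columns, so row balance passes from the shape to the sets
  \<open>lo x\<close>.\<close>

lemma balanced_diagram_of_shape:
  assumes w: "w permutes {1..n}" and shape: "balanced_shape \<sigma> a b" and vex: "skew_vexillary_of_shape n w \<sigma>"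
  shows "balanced_diagram n w" "card (inversion_diagram.rows n w) = a" "card (inversion_diagram.cols n w) = b" "a > 0"
proof -
  interpret inversion_diagram n w by unfold_locales (fact w)
  interpret balanced_shape \<sigma> a b by (fact shape)
  obtain f g where fg: "bij f" "bij g" "map_prod f g ` rothe_diagram n w = \<sigma>"
    using vex by (auto simp: skew_vexillary_of_shape_def)
  \<comment> \<open>The bijection \<open>f\<close> acts on positions and \<open>g\<close> on values;
    precomposing \<open>f\<close> with \<open>inv w\<close> lets both act on letters.\<close>
  define F where "F x = f (int (inv w x))" for x
  define G where "G y = g (int y)" for y :: nat
  have injF: "inj F"
    by (rule injI) (simp add: F_def inj_eq[OF bij_is_inj[OF fg(1)]] inv_w_inj)
  have injG: "inj G"
    by (rule injI) (simp add: G_def inj_eq[OF bij_is_inj[OF fg(2)]])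
  have inv_w: "inv w (w i) = i" "w (inv w y) = y" for i y
    using permutes_inverses[OF w] by auto
  have range: "inv w x \<in> {1..n} \<longleftrightarrow> x \<in> {1..n}" for x
    by (rule permutes_in_image[OF permutes_inv[OF w]])
  have rothe: "(int (inv w x), int y) \<in> rothe_diagram n w \<longleftrightarrow> y \<in> lo x" for x y
  proof -
    have "(int (inv w x), int y) \<in> rothe_diagram n w \<longleftrightarrow> (inv w x, inv w y) \<in> Inversions n w"
    proof
      assume "(int (inv w x), int y) \<in> rothe_diagram n w"
      then obtain j where "(inv w x, j) \<in> Inversions n w" "y = w j"
        by (auto simp: rothe_diagram_def)
      then show "(inv w x, inv w y) \<in> Inversions n w" using inv_w by simp
    next
      assume "(inv w x, inv w y) \<in> Inversions n w"
      moreover have "(int (inv w x), int y) = (int (inv w x), int (w (inv w y)))" using inv_w by simp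
      ultimately show "(int (inv w x), int y) \<in> rothe_diagram n w"
        unfolding rothe_diagram_def by blast
    qed
    also have "\<dots> \<longleftrightarrow> y \<in> lo x"
      using range[of x] range[of y] by (auto simp: Inversions_def lo_iff inv_w)
    finally show ?thesis .
  qed
  have mem: "(F x, G y) \<in> \<sigma> \<longleftrightarrow> y \<in> lo x" for x y
  proof -
    have "(F x, G y) = map_prod f g (int (inv w x), int y)" by (simp add: F_def G_def)
    moreover have "inj (map_prod f g)"
      using prod.inj_map[OF bij_is_inj[OF fg(1)] bij_is_inj[OF fg(2)]] .
    ultimately have "(F x, G y) \<in> \<sigma> \<longleftrightarrow> (int (inv w x), int y) \<in> rothe_diagram n w"
      unfolding fg(3)[symmetric] by (simp only: inj_image_mem_iff)
    then show ?thesis using rothe by simp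
  qed
  have surj: "\<exists>x y. r = F x \<and> c = G y" if rc: "(r, c) \<in> \<sigma>" for r c
  proof -
    obtain z where "z \<in> rothe_diagram n w" and z: "(r, c) = map_prod f g z"
      using rc unfolding fg(3)[symmetric] by (elim imageE)
    then obtain i j where "z = (int i, int (w j))" by (auto simp: rothe_diagram_def)
    with z have "(r, c) = map_prod f g (int i, int (w j))" by simp
    then show ?thesis by (intro exI[of _ "w i"] exI[of _ "w j"]) (simp add: F_def G_def inv_w)
  qed
  have row_F: "row (F x) = G ` lo x" for x
  proof
    show "row (F x) \<subseteq> G ` lo x"
    proof
      fix c assume "c \<in> row (F x)"
      then have c: "(F x, c) \<in> \<sigma>" by (simp add: row_def)
      then obtain x' y where "F x = F x'" "c = G y" using surj by blast
      then show "c \<in> G ` lo x" using c mem by blast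
    qed
    show "G ` lo x \<subseteq> row (F x)" using mem by (auto simp: row_def)
  qed
  have rows: "F ` rows = {1..int a}"
  proof
    show "F ` rows \<subseteq> {1..int a}"
      using mem mem_bounds by (fastforce simp: rows_def)
    show "{1..int a} \<subseteq> F ` rows"
    proof
      fix i assume "i \<in> {1..int a}"
      then obtain c where "(i, c) \<in> \<sigma>" using row_nonempty by auto
      then show "i \<in> F ` rows" using surj[of i c] mem by (auto simp: rows_def)
    qed
  qed
  have cols: "G ` cols = {1..int b}"
  proof
    show "G ` cols \<subseteq> {1..int b}"
      using mem mem_bounds by (fastforce simp: cols_def)
    show "{1..int b} \<subseteq> G ` cols"
    proof
      fix j assume "j \<in> {1..int b}"
      then obtain r where "(r, j) \<in> \<sigma>" using col_nonempty by auto
      then show "j \<in> G ` cols" using surj[of r j] mem by (auto simp: cols_def)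
    qed
  qed
  show a: "card rows = a"
    using card_image[OF inj_on_subset[OF injF], of rows] rows by simp
  show b: "card cols = b"
    using card_image[OF inj_on_subset[OF injG], of cols] cols by simp
  show "a > 0" using nonempty mem_bounds by force
  show "balanced_diagram n w"
  proof
    fix x y
    show "int (card cols) * int (card {t \<in> rows. lo t \<subseteq> lo x \<inter> lo y}) = int (card rows) * int (card (lo x \<inter> lo y))"
    proof (cases "x \<in> rows \<and> y \<in> rows")
      case False
      \<comment> \<open>One of the two sets is empty, and letters in \<open>rows\<close> have
        nonempty rows, so both counts are \<open>0\<close>.\<close>
      then have "lo x \<inter> lo y = {}" by (auto simp: rows_def)
      moreover have "{t \<in> rows. lo t \<subseteq> {}} = {}" by (auto simp: rows_def)
      ultimately show ?thesis by (simp only: card.empty)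
    next
      case True
      then have xy: "F x \<in> {1..int a}" "F y \<in> {1..int a}" using rows by blast+
      have inter: "row (F x) \<inter> row (F y) = G ` (lo x \<inter> lo y)"
        unfolding row_F using injG by (simp add: image_Int)
      have "row (F t) \<subseteq> G ` (lo x \<inter> lo y) \<longleftrightarrow> lo t \<subseteq> lo x \<inter> lo y" for t
        by (simp only: row_F inj_image_subset_iff[OF injG])
      then have "{t \<in> {1..int a}. row t \<subseteq> row (F x) \<inter> row (F y)} = F ` {t \<in> rows. lo t \<subseteq> lo x \<inter> lo y}"
        unfolding inter rows[symmetric] by blast
      moreover have "card (F ` {t \<in> rows. lo t \<subseteq> lo x \<inter> lo y}) = card {t \<in> rows. lo t \<subseteq> lo x \<inter> lo y}"
        by (rule card_image) (rule inj_on_subset[OF injF], simp)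
      moreover have "card (G ` (lo x \<inter> lo y)) = card (lo x \<inter> lo y)"
        by (rule card_image) (rule inj_on_subset[OF injG], simp)
      ultimately show ?thesis
        using card_rows_in_inter[of "F x" "F y"] xy unfolding inter a b by simp
    qed
  qed
qed

theorem theorem1p3:
  fixes lam nu :: "nat list" and \<sigma> :: "(int \<times> int) set"
    and a b n :: nat and w :: "nat \<Rightarrow> nat"
  assumes "is_partition lam" and "is_partition nu" and "partition_contained nu lam"
    and "\<sigma> = skew_shape lam nu"
    and "balanced \<sigma>" and "has_height_width \<sigma> a b"
    and "w permutes {1..n}" and "skew_vexillary_of_shape n w \<sigma>"
  shows "CDE (weak_interval n id w) (weak_le n) \<and>
    edge_density (weak_interval n id w) (weak_le n) = real (a * b) / real (a + b)"
proof -
  have "order_convex \<sigma>" using order_convex_skew_shape assms by simp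
  then obtain v where "balanced_shape (translate v \<sigma>) a b"
    using ex_balanced_shape assms by blast
  note diagram = balanced_diagram_of_shape[OF assms(7) this skew_vexillary_translate[OF assms(8)]]
  interpret balanced_diagram n w by (fact diagram)
  show ?thesis
    using expect_uni expect_maxchain diagram by (simp add: CDE_def edge_density_def)
qed

end
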